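(* The following problem is undecidable: given an integral NMDA $\mathcal{N}$ and an integral DMDA $\mathcal{D}$ over the same alphabet $\Sigma$, decide whether $\mathcal{N}(w)\leq\mathcal{D}(w)$ for all infinite words $w\in\Sigma^\omega$.
   Context: An alphabet $\Sigma$ is a finite nonempty set. An NMDA is a tuple $\mathcal{A}=\langle \Sigma,Q,\iota,\delta,\gamma,\rho\rangle$ with finite state set $Q$, initial states $\iota\subseteq Q$, transition relation $\delta\subseteq Q\times\Sigma\times Q$, weight function $\gamma:\delta\to\mathbb{Q}$ and discount-factor function $\rho:\delta\to\mathbb{Q}\cap(1,\infty)$; NMDAs are assumed complete (every state has at least one outgoing transition on every letter). A run on an infinite word $w=\sigma_0\sigma_1\cdots$ is $p_0,\sigma_0,p_1,\ldots$ with $p_0\in\iota$ and $t_i=(p_i,\sigma_i,p_{i+1})\in\delta$; its value is $\sum_{i=0}^{\infty}\gamma(t_i)\prod_{j<i}\frac{1}{\rho(t_j)}$, and $\mathcal{A}(w)$ is the infimum of values of runs on $w$. A DMDA is an NMDA with $|\iota|=1$ and at most one successor per state and letter. An NMDA is integral if all discount factors are integers. *)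

theory Defs
  imports Complex_Main "HOL-Library.Extended_Real" "HOL-Library.Nat_Bijection"
begin

section \<open>Nondeterministic discounted-sum automata with multiple discount factors\<close>

record ('a, 'q) nmda =
  alphabet :: "'a set"
  states :: "'q set"
  initial :: "'q set"
  transitions :: "('q \<times> 'a \<times> 'q) set"
  weight :: "'q \<times> 'a \<times> 'q \<Rightarrow> rat"
  discount :: "'q \<times> 'a \<times> 'q \<Rightarrow> rat"

text \<open>Only the values of \<open>weight\<close> and \<open>discount\<close> on \<open>transitions\<close> are meaningful.\<close>

definition is_nmda :: "('a, 'q) nmda \<Rightarrow> bool" where
  "is_nmda A \<longleftrightarrow>
     finite (alphabet A) \<and> alphabet A \<noteq> {} \<and>
     finite (states A) \<and>
     initial A \<subseteq> states A \<and>
     transitions A \<subseteq> states A \<times> alphabet A \<times> states A \<and>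
     (\<forall>t\<in>transitions A. discount A t > 1) \<and>
     (\<forall>p\<in>states A. \<forall>a\<in>alphabet A. \<exists>q. (p, a, q) \<in> transitions A)"

definition is_dmda :: "('a, 'q) nmda \<Rightarrow> bool" where
  "is_dmda A \<longleftrightarrow>
     is_nmda A \<and> card (initial A) = 1 \<and>
     (\<forall>p a q q'. (p, a, q) \<in> transitions A \<and> (p, a, q') \<in> transitions A \<longrightarrow> q = q')"

definition is_integral :: "('a, 'q) nmda \<Rightarrow> bool" where
  "is_integral A \<longleftrightarrow> (\<forall>t\<in>transitions A. discount A t \<in> \<int>)"

definition words :: "'a set \<Rightarrow> (nat \<Rightarrow> 'a) set" where
  "words \<Sigma> = {w. \<forall>i. w i \<in> \<Sigma>}"

definition step :: "(nat \<Rightarrow> 'a) \<Rightarrow> (nat \<Rightarrow> 'q) \<Rightarrow> nat \<Rightarrow> 'q \<times> 'a \<times> 'q" where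
  "step w r i = (r i, w i, r (Suc i))"

definition runs :: "('a, 'q) nmda \<Rightarrow> (nat \<Rightarrow> 'a) \<Rightarrow> (nat \<Rightarrow> 'q) set" where
  "runs A w = {r. r 0 \<in> initial A \<and> (\<forall>i. step w r i \<in> transitions A)}"

definition run_value :: "('a, 'q) nmda \<Rightarrow> (nat \<Rightarrow> 'a) \<Rightarrow> (nat \<Rightarrow> 'q) \<Rightarrow> real" where
  "run_value A w r =
     (\<Sum>i. of_rat (weight A (step w r i)) * (\<Prod>j<i. 1 / of_rat (discount A (step w r j))))"

text \<open>The infimum is taken in the extended reals, so that an automaton without initial states
  has the value \<open>\<infinity>\<close> on every word.\<close>

definition nmda_value :: "('a, 'q) nmda \<Rightarrow> (nat \<Rightarrow> 'a) \<Rightarrow> ereal" where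
  "nmda_value A w = (INF r\<in>runs A w. ereal (run_value A w r))"

lemma run_value_summable:
  assumes A: "is_nmda A" and r: "r \<in> runs A w"
  shows "summable (\<lambda>i. of_rat (weight A (step w r i)) *
           (\<Prod>j<i. 1 / of_rat (discount A (step w r j))) :: real)"
proof -
  let ?t = "step w r"
  have t: "?t i \<in> transitions A" for i
    using r by (simp add: runs_def)
  have "finite (transitions A)"
    using A by (auto simp: is_nmda_def intro: finite_subset)
  hence fin: "finite (f ` transitions A)" for f :: "_ \<Rightarrow> real"
    by simp
  define W where "W = Max ((\<lambda>t. \<bar>of_rat (weight A t) :: real\<bar>) ` transitions A)"
  define c where "c = Max ((\<lambda>t. 1 / of_rat (discount A t) :: real) ` transitions A)"
  have W: "\<bar>of_rat (weight A (?t i))\<bar> \<le> W" for i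
    unfolding W_def by (rule Max_ge[OF fin]) (use t in auto)
  have c: "1 / of_rat (discount A (?t i)) \<le> c" for i
    unfolding c_def by (rule Max_ge[OF fin]) (use t in auto)
  have gt1: "(of_rat (discount A u) :: real) > 1" if "u \<in> transitions A" for u
    using A that by (auto simp: is_nmda_def)
  have "c \<in> (\<lambda>t. 1 / of_rat (discount A t)) ` transitions A"
    unfolding c_def using t[of 0] by (intro Max_in fin) auto
  hence c01: "0 < c" "c < 1"
    using gt1 by force+
  have prod: "0 \<le> (\<Prod>j<i. 1 / of_rat (discount A (?t j)) :: real) \<and>
      (\<Prod>j<i. 1 / of_rat (discount A (?t j)) :: real) \<le> c ^ i" for i
  proof
    have nn: "0 \<le> (1 / of_rat (discount A (?t j)) :: real)" for j
      using gt1[OF t[of j]] by simp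
    show "0 \<le> (\<Prod>j<i. 1 / of_rat (discount A (?t j)) :: real)"
      using nn by (intro prod_nonneg) auto
    have "(\<Prod>j<i. 1 / of_rat (discount A (?t j)) :: real) \<le> (\<Prod>j<i. c)"
      using nn c by (intro prod_mono) auto
    thus "(\<Prod>j<i. 1 / of_rat (discount A (?t j)) :: real) \<le> c ^ i"
      by simp
  qed
  show ?thesis
  proof (rule summable_comparison_test')
    show "summable (\<lambda>i. W * c ^ i)"
      using c01 by (intro summable_mult summable_geometric) auto
    fix i :: nat
    have "0 \<le> W"
      by (rule order_trans[OF abs_ge_zero W[of i]])
    thus "norm (of_rat (weight A (?t i)) *
        (\<Prod>j<i. 1 / of_rat (discount A (?t j))) :: real) \<le> W * c ^ i"
      unfolding real_norm_def abs_mult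
      using W[of i] prod[of i] by (intro mult_mono) auto
  qed
qed


section \<open>Partial recursive functions and decision problems\<close>

datatype recf =
    Zero
  | Succ
  | Proj nat
  | Comp recf "recf list"
  | PrimRec recf recf
  | Mu recf

text \<open>\<open>recf_eval f xs y\<close>: the partial recursive function denoted by \<open>f\<close> is defined on the
  argument tuple \<open>xs\<close> and has the value \<open>y\<close> there. Terms carry no arity; the length of the
  argument list fixes the arities of all subterms, and ill-formed applications are undefined.
  The recursion variable and the variable bound by minimisation are the first argument.\<close>

inductive recf_eval :: "recf \<Rightarrow> nat list \<Rightarrow> nat \<Rightarrow> bool" where
  Zero: "recf_eval Zero xs 0"
| Succ: "recf_eval Succ [x] (Suc x)"
| Proj: "i < length xs \<Longrightarrow> recf_eval (Proj i) xs (xs ! i)"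
| Comp: "list_all2 (\<lambda>g y. recf_eval g xs y) gs ys \<Longrightarrow> recf_eval f ys z \<Longrightarrow>
    recf_eval (Comp f gs) xs z"
| PrimRec_0: "recf_eval f xs y \<Longrightarrow> recf_eval (PrimRec f g) (0 # xs) y"
| PrimRec_Suc: "recf_eval (PrimRec f g) (n # xs) y \<Longrightarrow> recf_eval g (n # y # xs) z \<Longrightarrow>
    recf_eval (PrimRec f g) (Suc n # xs) z"
| Mu: "recf_eval f (n # xs) 0 \<Longrightarrow> (\<forall>i<n. \<exists>y. recf_eval f (i # xs) (Suc y)) \<Longrightarrow>
    recf_eval (Mu f) xs n"

lemma recf_eval_deterministic:
  "recf_eval f xs y \<Longrightarrow> recf_eval f xs z \<Longrightarrow> y = z"
proof (induction f xs y arbitrary: z rule: recf_eval.induct)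
  case (Zero xs)
  thus ?case by cases auto
next
  case (Succ x)
  thus ?case by cases auto
next
  case (Proj i xs)
  from Proj.prems show ?case by cases auto
next
  case (Comp xs gs ys f z')
  from Comp.prems obtain ys' where ys': "list_all2 (\<lambda>g y. recf_eval g xs y) gs ys'"
    "recf_eval f ys' z"
    by cases auto
  have "ys = ys'"
    using Comp.IH(1) ys'(1) by (auto simp: list_all2_conv_all_nth intro: nth_equalityI)
  thus ?case using Comp.IH(2) ys'(2) by blast
next
  case (PrimRec_0 f xs y g)
  from PrimRec_0.prems show ?case by cases (auto intro: PrimRec_0.IH)
next
  case (PrimRec_Suc f g n xs y z')
  from PrimRec_Suc.prems show ?case
    by cases (use PrimRec_Suc.IH in blast)
next
  case (Mu f n xs)
  from Mu.prems show ?case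
  proof cases
    case Mu
    show ?thesis
      using Mu Mu.IH by (metis linorder_neqE_nat nat.distinct(1))
  qed
qed

text \<open>A decision problem consists of a set of admissible instances \<open>I\<close>, a question \<open>P\<close> about them
  and an encoding of instances as natural numbers. Nothing is required of a decision procedure on
  numbers that do not encode an admissible instance.\<close>

definition decidable :: "('i \<Rightarrow> nat) \<Rightarrow> 'i set \<Rightarrow> ('i \<Rightarrow> bool) \<Rightarrow> bool" where
  "decidable enc I P \<longleftrightarrow>
     (\<exists>f. \<forall>x\<in>I. recf_eval f [enc x] (if P x then 1 else 0))"


section \<open>Encoding of automata\<close>

text \<open>Letters and states of an input automaton are natural numbers, which is no restriction up to
  renaming. The code lists exactly the data of the automaton: the alphabet, the states, the initial
  states and the transitions together with their weights and discount factors, the latter as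
  numerators and denominators in lowest terms.\<close>

definition rat_encode :: "rat \<Rightarrow> nat" where
  "rat_encode x =
     prod_encode (int_encode (fst (quotient_of x)), int_encode (snd (quotient_of x)))"

definition trans_encode :: "(nat, nat) nmda \<Rightarrow> nat \<times> nat \<times> nat \<Rightarrow> nat" where
  "trans_encode A t =
     (case t of (p, a, q) \<Rightarrow>
        list_encode [p, a, q, rat_encode (weight A t), rat_encode (discount A t)])"

definition nmda_encode :: "(nat, nat) nmda \<Rightarrow> nat" where
  "nmda_encode A =
     list_encode [set_encode (alphabet A), set_encode (states A), set_encode (initial A),
       set_encode (trans_encode A ` transitions A)]"

lemma rat_encode_inject: "rat_encode x = rat_encode y \<longleftrightarrow> x = y"
  by (auto simp: rat_encode_def int_encode_eq intro: quotient_of_inject prod_eqI)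

lemma nmda_encode_inject:
  assumes "is_nmda A" and "is_nmda B" and eq: "nmda_encode A = nmda_encode B"
  shows "alphabet A = alphabet B" and "states A = states B" and "initial A = initial B"
    and "transitions A = transitions B"
    and "\<And>t. t \<in> transitions A \<Longrightarrow> weight A t = weight B t \<and> discount A t = discount B t"
proof -
  have fin: "finite (alphabet C)" "finite (states C)" "finite (initial C)" "finite (transitions C)"
    if "is_nmda C" for C :: "(nat, nat) nmda"
    using that by (auto simp: is_nmda_def intro: finite_subset)
  note fin = fin[OF assms(1)] fin[OF assms(2)]
  show "alphabet A = alphabet B" "states A = states B" "initial A = initial B"
    using eq fin by (auto simp: nmda_encode_def set_encode_eq)
  have img: "trans_encode A ` transitions A = trans_encode B ` transitions B"
    using eq fin by (auto simp: nmda_encode_def set_encode_eq)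
  have inj: "t = u \<and> weight C t = weight D u \<and> discount C t = discount D u"
    if "trans_encode C t = trans_encode D u" for C D t u
    using that by (cases t; cases u) (auto simp: trans_encode_def rat_encode_inject)
  show T: "transitions A = transitions B"
  proof (intro equalityI subsetI)
    fix t assume "t \<in> transitions A"
    then obtain u where "u \<in> transitions B" "trans_encode A t = trans_encode B u"
      using img by (metis imageE imageI)
    thus "t \<in> transitions B" using inj by blast
  next
    fix t assume "t \<in> transitions B"
    then obtain u where "u \<in> transitions A" "trans_encode B t = trans_encode A u"
      using img by (metis imageE imageI)
    thus "t \<in> transitions A" using inj by blast
  qed
  fix t assume "t \<in> transitions A"
  then obtain u where "trans_encode A t = trans_encode B u"
    using img by (metis imageE imageI)
  thus "weight A t = weight B t \<and> discount A t = discount B t"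
    using inj by blast
qed

definition pair_encode :: "(nat, nat) nmda \<times> (nat, nat) nmda \<Rightarrow> nat" where
  "pair_encode = (\<lambda>(N, D). prod_encode (nmda_encode N, nmda_encode D))"

end

theory Submission
  imports Defs "HOL-Library.Countable"
begin

text \<open>Words encode runs of nondeterministic counter programs over integer registers with increments,
  decrements and tests \<open>r\<^sub>a \<le> r\<^sub>b\<close>; one further letter marks the end of a run. The deterministic
  automaton has all discount factors 4 and the weight \<open>- 2\<close> on the first end mark. The
  nondeterministic automaton guesses why a word fails to encode an accepting run. An error of the
  control flow is seen by a finite automaton, which then behaves like the deterministic one. To claim
  that a test \<open>r\<^sub>a \<le> r\<^sub>b\<close> fails, the automaton uses the discount factors 2 and 8 for changes
  of \<open>r\<^sub>a\<close> and \<open>r\<^sub>b\<close>, so that its accumulated discount is \<open>2 ^ (r\<^sub>a - r\<^sub>b)\<close> times that of the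
  deterministic automaton; a payment of \<open>- 1\<close> then undercuts the payment of \<open>- 2\<close> iff
  \<open>r\<^sub>a > r\<^sub>b\<close>. Hence containment fails exactly if there is an accepting run.

  The input \<open>n\<close> of the program enters only through the two weights \<open>- 2 ^ n\<close> and
  \<open>- 1 / 2 ^ n\<close>, so the code of an instance is a simple function of \<open>n\<close> and of a few numbers
  that describe the rest of the automata. No universal machine is needed: given a decision procedure,
  some program accepts \<open>n\<close> iff \<open>n\<close> is the code of such numbers and the procedure claims
  containment for the instance that they form together with the input \<open>n\<close>; running the program
  on the numbers obtained from itself is contradictory.\<close>


section \<open>Counter programs\<close>

datatype instr = Inc nat | Dec nat | Le nat nat

instance instr :: countable
  by countable_datatype

type_synonym store = "nat \<Rightarrow> int"

fun effect :: "instr \<Rightarrow> nat \<Rightarrow> int" where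
  "effect (Inc a) r = (if r = a then 1 else 0)"
| "effect (Dec a) r = (if r = a then - 1 else 0)"
| "effect (Le a b) r = 0"

text \<open>The change of the store goes through \<open>effect\<close> because the discount factors
  of \<open>Compare\<close> are defined from the same function. Registers range over the integers,
  so a decrement never blocks.\<close>

definition instr_sem :: "instr \<Rightarrow> (store \<times> store) set" where
  "instr_sem c = {(s, t). t = (\<lambda>r. s r + effect c r) \<and> (\<forall>a b. c = Le a b \<longrightarrow> s a \<le> s b)}"

datatype prog = Op instr | Seq prog prog | Star prog

primrec sem :: "prog \<Rightarrow> (store \<times> store) set" where
  "sem (Op c) = instr_sem c"
| "sem (Seq P Q) = sem P O sem Q"
| "sem (Star P) = (sem P)\<^sup>*"

lemma instr_sem_simps [simp]:
  "(s, t) \<in> instr_sem (Inc a) \<longleftrightarrow> t = s(a := s a + 1)"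
  "(s, t) \<in> instr_sem (Dec a) \<longleftrightarrow> t = s(a := s a - 1)"
  "(s, t) \<in> instr_sem (Le a b) \<longleftrightarrow> t = s \<and> s a \<le> s b"
  by (auto simp: instr_sem_def fun_eq_iff)

lemma instr_sem_relcomp [simp]:
  "(s, t) \<in> instr_sem (Inc a) O R \<longleftrightarrow> (s(a := s a + 1), t) \<in> R"
  "(s, t) \<in> instr_sem (Dec a) O R \<longleftrightarrow> (s(a := s a - 1), t) \<in> R"
  "(s, t) \<in> instr_sem (Le a b) O R \<longleftrightarrow> s a \<le> s b \<and> (s, t) \<in> R"
  by auto

section \<open>Flow graphs\<close>

type_synonym edge = "nat \<times> instr \<times> nat"

definition graph_step :: "edge set \<Rightarrow> ((nat \<times> store) \<times> (nat \<times> store)) set" where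
  "graph_step E = {((p, s), (q, t)). \<exists>c. (p, c, q) \<in> E \<and> (s, t) \<in> instr_sem c}"

lemma graph_step_mono: "E \<subseteq> F \<Longrightarrow> graph_step E \<subseteq> graph_step F"
  by (auto simp: graph_step_def)

lemma graph_steps_mono: "x \<in> (graph_step E)\<^sup>* \<Longrightarrow> E \<subseteq> F \<Longrightarrow> x \<in> (graph_step F)\<^sup>*"
  using rtrancl_mono[OF graph_step_mono] by blast

text \<open>The edges labelled \<open>Le 0 0\<close> do nothing. The entry of a loop is a node of its own because the
  entry of the body may itself be the target of edges.\<close>

fun flow :: "prog \<Rightarrow> nat \<Rightarrow> edge set \<times> nat" where
  "flow (Op c) i = ({(i, c, Suc i)}, Suc i)"
| "flow (Seq P Q) i = (let (E, j) = flow P i; (F, k) = flow Q j in (E \<union> F, k))"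
| "flow (Star P) i = (let (E, j) = flow P (Suc i) in
     (E \<union> {(i, Le 0 0, Suc i), (j, Le 0 0, i), (i, Le 0 0, Suc j)}, Suc j))"

text \<open>Within a fragment no edge leaves the exit node \<open>j\<close>, and consecutive
  fragments meet only in their boundary node; this is what allows their invariants to be glued
  together.\<close>

lemma flow_bounds:
  "flow P i = (E, j) \<Longrightarrow> finite E \<and> i < j \<and> (\<forall>(p, c, q)\<in>E. i \<le> p \<and> p < j \<and> i \<le> q \<and> q \<le> j)"
proof (induction P arbitrary: i E j)
  case (Seq P Q)
  obtain A k B l where *: "flow P i = (A, k)" "flow Q k = (B, l)"
    by (metis surj_pair)
  from Seq.IH(1)[OF *(1)] Seq.IH(2)[OF *(2)] Seq.prems * show ?case
    by fastforce
next
  case (Star P)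
  obtain A k where *: "flow P (Suc i) = (A, k)"
    by (metis surj_pair)
  from Star.IH[OF *] Star.prems * show ?case
    by fastforce
qed auto

lemma flow_complete:
  "flow P i = (E, j) \<Longrightarrow> (s, t) \<in> sem P \<Longrightarrow> ((i, s), (j, t)) \<in> (graph_step E)\<^sup>*"
proof (induction P arbitrary: i E j s t)
  case (Op c)
  thus ?case by (auto simp: graph_step_def intro!: r_into_rtrancl)
next
  case (Seq P Q)
  obtain A k B l where *: "flow P i = (A, k)" "flow Q k = (B, l)"
    by (metis surj_pair)
  from Seq.prems obtain u where u: "(s, u) \<in> sem P" "(u, t) \<in> sem Q"
    by auto
  have E: "E = A \<union> B" "j = l"
    using Seq.prems * by auto
  have "((i, s), (k, u)) \<in> (graph_step E)\<^sup>*" "((k, u), (l, t)) \<in> (graph_step E)\<^sup>*"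
    using Seq.IH(1)[OF *(1) u(1)] Seq.IH(2)[OF *(2) u(2)] E by (auto intro: graph_steps_mono)
  thus ?case using E by auto
next
  case (Star P)
  obtain A k where *: "flow P (Suc i) = (A, k)"
    by (metis surj_pair)
  have E: "E = A \<union> {(i, Le 0 0, Suc i), (k, Le 0 0, i), (i, Le 0 0, Suc k)}" "j = Suc k"
    using Star.prems * by auto
  have nop: "((p, u), (q, u)) \<in> graph_step E" if "(p, Le 0 0, q) \<in> E" for p q u
    using that by (force simp: graph_step_def)
  have "((i, s), (i, t)) \<in> (graph_step E)\<^sup>*"
    using Star.prems(2)[simplified]
  proof (induction rule: rtrancl_induct)
    case (step u v)
    have "((Suc i, u), (k, v)) \<in> (graph_step E)\<^sup>*"
      using Star.IH[OF * step(2)] E by (auto intro: graph_steps_mono)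
    moreover have "((i, u), (Suc i, u)) \<in> graph_step E" "((k, v), (i, v)) \<in> graph_step E"
      using nop E by auto
    ultimately show ?case
      using step.IH by (meson rtrancl.rtrancl_into_rtrancl rtrancl_trans)
  qed simp
  moreover have "((i, t), (j, t)) \<in> graph_step E"
    using nop E by auto
  ultimately show ?case
    by (rule rtrancl_into_rtrancl)
qed

text \<open>\<open>J p s t\<close> is an invariant read backwards: from node \<open>p\<close> with store \<open>s\<close> the program may
  leave with store \<open>t\<close>.\<close>

lemma flow_invariant:
  "flow P i = (E, j) \<Longrightarrow> \<exists>J. (\<forall>p c q s s' t. (p, c, q) \<in> E \<and> (s, s') \<in> instr_sem c \<and> J q s' t \<longrightarrow> J p s t) \<and>
     (\<forall>s. J j s s) \<and> (\<forall>s t. J i s t \<longrightarrow> (s, t) \<in> sem P)"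
proof (induction P arbitrary: i E j)
  case (Op c)
  show ?case
    by (rule exI[of _ "\<lambda>p s t. if p = i then (s, t) \<in> sem (Op c) else s = t"]) (use Op in auto)
next
  case (Seq P Q)
  obtain A k B l where *: "flow P i = (A, k)" "flow Q k = (B, l)"
    by (metis surj_pair)
  have E: "E = A \<union> B" "j = l"
    using Seq.prems * by auto
  obtain J where J: "\<And>p c q s s' t. (p, c, q) \<in> A \<Longrightarrow> (s, s') \<in> instr_sem c \<Longrightarrow> J q s' t \<Longrightarrow> J p s t"
     "\<And>s. J k s s" "\<And>s t. J i s t \<Longrightarrow> (s, t) \<in> sem P"
    using Seq.IH(1)[OF *(1)] by blast
  obtain L where L: "\<And>p c q s s' t. (p, c, q) \<in> B \<Longrightarrow> (s, s') \<in> instr_sem c \<Longrightarrow> L q s' t \<Longrightarrow> L p s t"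
     "\<And>s. L l s s" "\<And>s t. L k s t \<Longrightarrow> (s, t) \<in> sem Q"
    using Seq.IH(2)[OF *(2)] by blast
  have b: "i < k" "k < l" "\<And>p c q. (p, c, q) \<in> A \<Longrightarrow> p < k \<and> q \<le> k"
    "\<And>p c q. (p, c, q) \<in> B \<Longrightarrow> k \<le> p \<and> k \<le> q"
    using flow_bounds[OF *(1)] flow_bounds[OF *(2)] by auto
  \<comment> \<open>Before the boundary node \<open>k\<close> the first program still has to finish
    before the second one runs; from \<open>k\<close> on only the second one is left.\<close>
  define M where "M p s t = (if p < k then \<exists>u. J p s u \<and> (u, t) \<in> sem Q else L p s t)" for p s t
  have "M p s t" if "(p, c, q) \<in> E" "(s, s') \<in> instr_sem c" "M q s' t" for p c q s s' t
  proof (cases "(p, c, q) \<in> A")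
    case True
    hence "p < k" "q \<le> k" using b by auto
    show ?thesis
    proof (cases "q = k")
      case True
      \<comment> \<open>Entering \<open>k\<close> means leaving the first program: there
        \<open>M\<close> is the invariant of \<open>Q\<close>, and \<open>J\<close> holds for equal
        stores.\<close>
      hence "(s', t) \<in> sem Q" using that L(3) by (simp add: M_def)
      moreover have "J p s s'" using J(1)[OF \<open>(p, c, q) \<in> A\<close> that(2)] J(2) True by auto
      ultimately show ?thesis using \<open>p < k\<close> by (auto simp: M_def)
    next
      case False
      thus ?thesis using J(1)[OF \<open>(p, c, q) \<in> A\<close> that(2)] that(3) \<open>p < k\<close> \<open>q \<le> k\<close>
        by (auto simp: M_def)
    qed
  next
    case False
    hence "(p, c, q) \<in> B" using that E by auto
    thus ?thesis using L(1)[OF _ that(2)] that(3) b(4) by (fastforce simp: M_def)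
  qed
  moreover have "\<forall>s. M j s s" "\<forall>s t. M i s t \<longrightarrow> (s, t) \<in> sem (Seq P Q)"
    using b(1,2) J(3) L(2) E by (auto simp: M_def)
  ultimately show ?case by blast
next
  case (Star P)
  obtain A k where *: "flow P (Suc i) = (A, k)"
    by (metis surj_pair)
  have E: "E = A \<union> {(i, Le 0 0, Suc i), (k, Le 0 0, i), (i, Le 0 0, Suc k)}" "j = Suc k"
    using Star.prems * by auto
  obtain J where J: "\<And>p c q s s' t. (p, c, q) \<in> A \<Longrightarrow> (s, s') \<in> instr_sem c \<Longrightarrow> J q s' t \<Longrightarrow> J p s t"
     "\<And>s. J k s s" "\<And>s t. J (Suc i) s t \<Longrightarrow> (s, t) \<in> sem P"
    using Star.IH[OF *] by blast
  have b: "Suc i < k" "\<And>p c q. (p, c, q) \<in> A \<Longrightarrow> i < p \<and> p < k \<and> i < q \<and> q \<le> k"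
    using flow_bounds[OF *] by auto
  \<comment> \<open>At the loop entry any number of passes is left; inside the body the current pass
    ends first, as described by \<open>J\<close>, and then any number follows.\<close>
  define M where "M p s t = (if p = i then (s, t) \<in> sem (Star P) else if p = Suc k then s = t
    else \<exists>u. J p s u \<and> (u, t) \<in> sem (Star P))" for p s t
  have "M p s t" if "(p, c, q) \<in> E" "(s, s') \<in> instr_sem c" "M q s' t" for p c q s s' t
  proof (cases "(p, c, q) \<in> A")
    case True
    hence "i < p" "p < k" "i < q" "q \<le> k" using b by auto
    thus ?thesis using J(1)[OF True that(2)] that(3) by (auto simp: M_def)
  next
    case False
    with that(1,2) E(1) have st: "s' = s" and "p = i \<and> q = Suc i \<or> p = k \<and> q = i \<or> p = i \<and> q = Suc k"
      by auto
    then consider "p = i" "q = Suc i" | "p = k" "q = i" | "p = i" "q = Suc k" by blast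
    thus ?thesis
    proof cases
      case 1
      with that(3) b(1) st obtain u where "(s, u) \<in> sem P" "(u, t) \<in> sem (Star P)"
        using J(3) by (auto simp: M_def)
      thus ?thesis using 1 by (auto simp: M_def intro: converse_rtrancl_into_rtrancl)
    next
      case 2
      thus ?thesis using that(3) b(1) st J(2)[of s] by (auto simp: M_def)
    next
      case 3
      thus ?thesis using that(3) b(1) st by (auto simp: M_def)
    qed
  qed
  moreover have "\<forall>s. M j s s" "\<forall>s t. M i s t \<longrightarrow> (s, t) \<in> sem (Star P)"
    using b(1) E(2) by (auto simp: M_def)
  ultimately show ?case by blast
qed

lemma flow_sound:
  assumes "flow P i = (E, j)" "((i, s), (j, t)) \<in> (graph_step E)\<^sup>*"
  shows "(s, t) \<in> sem P"
proof -
  obtain J where J: "\<And>p c q s s' t. (p, c, q) \<in> E \<Longrightarrow> (s, s') \<in> instr_sem c \<Longrightarrow> J q s' t \<Longrightarrow> J p s t"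
     "\<And>s. J j s s" "\<And>s t. J i s t \<Longrightarrow> (s, t) \<in> sem P"
    using flow_invariant[OF assms(1)] by blast
  have "J p u t" if "((p, u), (j, t)) \<in> (graph_step E)\<^sup>*" for p u
    using that
    by (induction p u rule: converse_rtrancl_induct2) (auto simp: graph_step_def intro: J)
  thus ?thesis using J assms(2) by blast
qed


section \<open>Testing recursive relations\<close>

text \<open>The registers from \<open>k\<close> on are zero before and after a test and serve as its workspace.\<close>

definition is_test :: "nat \<Rightarrow> prog \<Rightarrow> ((nat \<Rightarrow> nat) \<Rightarrow> bool) \<Rightarrow> bool" where
  "is_test k P Q \<longleftrightarrow> (\<forall>\<sigma> t. (\<forall>x\<ge>k. \<sigma> x = 0) \<longrightarrow>
     (int \<circ> \<sigma>, t) \<in> sem P \<longleftrightarrow> t = int \<circ> \<sigma> \<and> Q \<sigma>)"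

lemma is_test_mono:
  "is_test k P Q \<Longrightarrow> l \<le> k \<Longrightarrow> is_test l P Q"
  unfolding is_test_def using order_trans by blast

lemma is_test_cong:
  "is_test k P Q \<Longrightarrow> (\<And>\<sigma>. (\<forall>x\<ge>k. \<sigma> x = 0) \<Longrightarrow> Q \<sigma> = Q' \<sigma>) \<Longrightarrow> is_test k P Q'"
  unfolding is_test_def by metis

lemma is_test_Le: "is_test k (Op (Le a b)) (\<lambda>\<sigma>. \<sigma> a \<le> \<sigma> b)"
  by (auto simp: is_test_def)

lemma is_test_Seq:
  "is_test k P Q \<Longrightarrow> is_test k P' Q' \<Longrightarrow> is_test k (Seq P P') (\<lambda>\<sigma>. Q \<sigma> \<and> Q' \<sigma>)"
  unfolding is_test_def by (simp add: relcomp_unfold) blast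

lemma is_test_eq: "is_test k (Seq (Op (Le a b)) (Op (Le b a))) (\<lambda>\<sigma>. \<sigma> a = \<sigma> b)"
  by (rule is_test_cong[OF is_test_Seq[OF is_test_Le is_test_Le]]) auto

text \<open>Register \<open>k\<close> becomes 1 while \<open>Suc k\<close> is still 0, so the
  comparison blocks.\<close>

lemma is_test_False: "is_test k (Seq (Op (Inc k)) (Op (Le k (Suc k)))) (\<lambda>_. False)"
  by (auto simp: is_test_def)

text \<open>Register \<open>a\<close> is raised for the comparison only and lowered again
  afterwards; with \<open>a = b\<close> both sides would be raised.\<close>

lemma is_test_Suc:
  "a \<noteq> b \<Longrightarrow> is_test k (Seq (Op (Inc a)) (Seq (Seq (Op (Le a b)) (Op (Le b a))) (Op (Dec a))))
     (\<lambda>\<sigma>. Suc (\<sigma> a) = \<sigma> b)"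
  by (auto simp: is_test_def O_assoc fun_eq_iff)

section \<open>Guessing and clearing registers\<close>

lemma sem_Star_Inc: "(s, t) \<in> sem (Star (Op (Inc k))) \<longleftrightarrow> (\<exists>v::nat. t = s(k := s k + int v))"
proof
  assume "(s, t) \<in> sem (Star (Op (Inc k)))"
  hence "(s, t) \<in> (instr_sem (Inc k))\<^sup>*" by simp
  thus "\<exists>v::nat. t = s(k := s k + int v)"
  proof (induction rule: rtrancl_induct)
    case base
    show ?case by (rule exI[of _ 0]) auto
  next
    case (step u v)
    then obtain x where "u = s(k := s k + int x)" by blast
    with step(2) show ?case by (intro exI[of _ "Suc x"]) auto
  qed
next
  have "(s, s(k := s k + int v)) \<in> (instr_sem (Inc k))\<^sup>*" for v
  proof (induction v)
    case (Suc v)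
    show ?case by (rule rtrancl_into_rtrancl[OF Suc]) auto
  qed simp
  thus "\<exists>v::nat. t = s(k := s k + int v) \<Longrightarrow> (s, t) \<in> sem (Star (Op (Inc k)))" by auto
qed

lemma sem_Star_Dec: "(s, t) \<in> sem (Star (Op (Dec k))) \<longleftrightarrow> (\<exists>v::nat. t = s(k := s k - int v))"
proof
  assume "(s, t) \<in> sem (Star (Op (Dec k)))"
  hence "(s, t) \<in> (instr_sem (Dec k))\<^sup>*" by simp
  thus "\<exists>v::nat. t = s(k := s k - int v)"
  proof (induction rule: rtrancl_induct)
    case base
    show ?case by (rule exI[of _ 0]) auto
  next
    case (step u v)
    then obtain x where "u = s(k := s k - int x)" by blast
    with step(2) show ?case by (intro exI[of _ "Suc x"]) auto
  qed
next
  have "(s, s(k := s k - int v)) \<in> (instr_sem (Dec k))\<^sup>*" for v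
  proof (induction v)
    case (Suc v)
    show ?case by (rule rtrancl_into_rtrancl[OF Suc]) auto
  qed simp
  thus "\<exists>v::nat. t = s(k := s k - int v) \<Longrightarrow> (s, t) \<in> sem (Star (Op (Dec k)))" by auto
qed

text \<open>There is no assignment: the register is lowered an arbitrary number of times, and the
  comparison with the zero register \<open>z\<close> rejects every wrong number of steps.\<close>

definition clear :: "nat \<Rightarrow> nat \<Rightarrow> prog" where
  "clear z k = Seq (Star (Op (Dec k))) (Seq (Op (Le k z)) (Op (Le z k)))"

lemma sem_clear:
  assumes "\<sigma> z = 0" "z \<noteq> k"
  shows "(int \<circ> \<sigma>, t) \<in> sem (clear z k) \<longleftrightarrow> t = int \<circ> \<sigma>(k := 0)"
proof
  assume "(int \<circ> \<sigma>, t) \<in> sem (clear z k)"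
  then obtain v :: nat where "t = (int \<circ> \<sigma>)(k := int (\<sigma> k) - int v)" "t k \<le> t z" "t z \<le> t k"
    by (auto simp: clear_def sem_Star_Dec simp del: sem.simps(3))
  thus "t = int \<circ> \<sigma>(k := 0)" using assms by (auto simp: fun_eq_iff)
next
  assume t: "t = int \<circ> \<sigma>(k := 0)"
  hence "(int \<circ> \<sigma>, t) \<in> sem (Star (Op (Dec k)))"
    unfolding sem_Star_Dec by (intro exI[of _ "\<sigma> k"]) (auto simp: fun_eq_iff)
  moreover have "(int \<circ> \<sigma>(k := 0), t) \<in> sem (Seq (Op (Le k z)) (Op (Le z k)))"
    using assms t by auto
  ultimately show "(int \<circ> \<sigma>, t) \<in> sem (clear z k)"
    unfolding clear_def sem.simps(2)[of "Star (Op (Dec k))"] t by (rule relcompI)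
qed

lemma sem_guess:
  assumes "\<sigma> k = 0"
  shows "(int \<circ> \<sigma>, t) \<in> sem (Star (Op (Inc k))) \<longleftrightarrow> (\<exists>v. t = int \<circ> \<sigma>(k := v))"
  using assms by (auto simp: sem_Star_Inc fun_eq_iff simp del: sem.simps)

lemma is_testD:
  "is_test k P Q \<Longrightarrow> \<forall>x\<ge>k. \<sigma> x = 0 \<Longrightarrow> (int \<circ> \<sigma>, t) \<in> sem P \<longleftrightarrow> t = int \<circ> \<sigma> \<and> Q \<sigma>"
  by (simp add: is_test_def)

lemma is_test_ex:
  assumes P: "is_test (Suc k) P Q"
  shows "is_test k (Seq (Star (Op (Inc k))) (Seq P (clear (Suc k) k))) (\<lambda>\<sigma>. \<exists>v. Q (\<sigma>(k := v)))"
  unfolding is_test_def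
proof (intro allI impI)
  fix \<sigma> :: "nat \<Rightarrow> nat" and t
  assume z: "\<forall>x\<ge>k. \<sigma> x = 0"
  have *: "(int \<circ> \<sigma>(k := v), t) \<in> sem (Seq P (clear (Suc k) k)) \<longleftrightarrow> t = int \<circ> \<sigma> \<and> Q (\<sigma>(k := v))" for v
  proof -
    have "(int \<circ> \<sigma>(k := v), u) \<in> sem P \<longleftrightarrow> u = int \<circ> \<sigma>(k := v) \<and> Q (\<sigma>(k := v))" for u
      by (rule is_testD[OF P]) (use z in auto)
    moreover have "(int \<circ> \<sigma>(k := v), t) \<in> sem (clear (Suc k) k) \<longleftrightarrow> t = int \<circ> (\<sigma>(k := v))(k := 0)"
      by (rule sem_clear) (use z in auto)
    moreover have "(\<sigma>(k := v))(k := 0) = \<sigma>" using z by auto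
    ultimately show ?thesis by (auto simp: relcomp_unfold)
  qed
  have "(int \<circ> \<sigma>, t) \<in> sem (Seq (Star (Op (Inc k))) (Seq P (clear (Suc k) k))) \<longleftrightarrow>
     (\<exists>u. (int \<circ> \<sigma>, u) \<in> sem (Star (Op (Inc k))) \<and> (u, t) \<in> sem (Seq P (clear (Suc k) k)))"
    by auto
  also have "\<dots> \<longleftrightarrow> (\<exists>v. (int \<circ> \<sigma>(k := v), t) \<in> sem (Seq P (clear (Suc k) k)))"
    using sem_guess[of \<sigma> k] z by (auto simp del: sem.simps)
  also have "\<dots> \<longleftrightarrow> t = int \<circ> \<sigma> \<and> (\<exists>v. Q (\<sigma>(k := v)))"
    unfolding * by auto
  finally show "(int \<circ> \<sigma>, t) \<in> sem (Seq (Star (Op (Inc k))) (Seq P (clear (Suc k) k))) \<longleftrightarrow>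
    t = int \<circ> \<sigma> \<and> (\<exists>v. Q (\<sigma>(k := v)))" .
qed

lemma ex_test_False: "(\<And>\<sigma>. \<not> Q \<sigma>) \<Longrightarrow> \<exists>P. is_test k P Q"
  by (rule exI, rule is_test_cong[OF is_test_False]) simp

section \<open>Counted loops as tests\<close>

inductive loop_reach :: "(nat \<Rightarrow> bool) \<Rightarrow> (nat \<Rightarrow> nat \<Rightarrow> nat \<Rightarrow> bool) \<Rightarrow> nat \<Rightarrow> nat \<Rightarrow> bool"
  for I R where
  start: "I y \<Longrightarrow> loop_reach I R 0 y"
| step: "loop_reach I R n y \<Longrightarrow> R n y z \<Longrightarrow> loop_reach I R (Suc n) z"

text \<open>Register \<open>k\<close> counts the iterations, \<open>k + 1\<close> holds the current value and \<open>k + 2\<close> a guess of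
  the next one.\<close>

definition loop_body :: "nat \<Rightarrow> prog \<Rightarrow> prog" where
  "loop_body k P = Seq (Star (Op (Inc (k + 2)))) (Seq P (Seq (clear (k + 3) (k + 1))
     (Seq (Star (Op (Inc (k + 1)))) (Seq (Seq (Op (Le (k + 1) (k + 2))) (Op (Le (k + 2) (k + 1))))
       (Seq (clear (k + 3) (k + 2)) (Op (Inc k)))))))"

definition loop :: "nat \<Rightarrow> prog \<Rightarrow> prog \<Rightarrow> prog \<Rightarrow> prog" where
  "loop k P0 P P1 = Seq (Star (Op (Inc (k + 1)))) (Seq P0 (Seq (Star (loop_body k P))
     (Seq P1 (Seq (clear (k + 2) (k + 1)) (clear (k + 2) k)))))"

lemma sem_Seq_assign:
  "(\<And>u. (s, u) \<in> sem P \<longleftrightarrow> u = s') \<Longrightarrow> (s, t) \<in> sem (Seq P Q) \<longleftrightarrow> (s', t) \<in> sem Q"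
  by auto

lemma sem_Seq_test:
  "(\<And>u. (s, u) \<in> sem P \<longleftrightarrow> u = s' \<and> A) \<Longrightarrow> (s, t) \<in> sem (Seq P Q) \<longleftrightarrow> A \<and> (s', t) \<in> sem Q"
  by auto

lemma sem_Seq_guess:
  "(\<And>u. (s, u) \<in> sem P \<longleftrightarrow> (\<exists>v. u = f v)) \<Longrightarrow>
    (s, t) \<in> sem (Seq P Q) \<longleftrightarrow> (\<exists>v. (f v, t) \<in> sem Q)"
  by auto

text \<open>In the hypothesis on \<open>P\<close> the three loop registers are reset in the first
  argument of \<open>R\<close>, so that the same relation \<open>R \<sigma>\<close> governs every
  pass.\<close>

lemma sem_loop_body:
  assumes P: "is_test (k + 3) P
      (\<lambda>\<sigma>. R (\<sigma>(k := 0, k + 1 := 0, k + 2 := 0)) (\<sigma> k) (\<sigma> (k + 1)) (\<sigma> (k + 2)))"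
    and z: "\<forall>x\<ge>k. \<sigma> x = 0"
  shows "(int \<circ> \<sigma>(k := i, k + 1 := y), t) \<in> sem (loop_body k P) \<longleftrightarrow>
    (\<exists>y'. R \<sigma> i y y' \<and> t = int \<circ> \<sigma>(k := Suc i, k + 1 := y'))"
proof -
  have base: "\<sigma>(k := 0, k + 1 := 0, k + 2 := 0) = \<sigma>"
    using z by auto
  have g: "(int \<circ> \<sigma>(k := i, k + 1 := y), t) \<in> sem (Star (Op (Inc (k + 2)))) \<longleftrightarrow>
      (\<exists>v. t = int \<circ> \<sigma>(k := i, k + 1 := y, k + 2 := v))" for t
    using sem_guess[of "\<sigma>(k := i, k + 1 := y)" "k + 2"] z by simp
  have p: "(int \<circ> \<sigma>(k := i, k + 1 := y, k + 2 := v), t) \<in> sem P \<longleftrightarrow>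
      t = int \<circ> \<sigma>(k := i, k + 1 := y, k + 2 := v) \<and> R \<sigma> i y v" for v t
    using is_testD[OF P, of "\<sigma>(k := i, k + 1 := y, k + 2 := v)" t] z base
    by (simp add: fun_upd_twist)
  have c: "(int \<circ> \<sigma>(k := i, k + 1 := y, k + 2 := v), t) \<in> sem (clear (k + 3) (k + 1)) \<longleftrightarrow>
      t = int \<circ> \<sigma>(k := i, k + 1 := 0, k + 2 := v)" for v t
    using sem_clear[of "\<sigma>(k := i, k + 1 := y, k + 2 := v)" "k + 3" "k + 1"] z
    by (simp add: fun_upd_twist)
  \<comment> \<open>Copying is not an instruction: \<open>k + 1\<close> is cleared, guessed anew and
    then compared with \<open>k + 2\<close>.\<close>
  have g': "(int \<circ> \<sigma>(k := i, k + 1 := 0, k + 2 := v), t) \<in> sem (Star (Op (Inc (k + 1)))) \<longleftrightarrow>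
      (\<exists>w. t = int \<circ> \<sigma>(k := i, k + 1 := w, k + 2 := v))" for v t
    using sem_guess[of "\<sigma>(k := i, k + 1 := 0, k + 2 := v)" "k + 1"] z
    by (simp add: fun_upd_twist)
  have e: "(int \<circ> \<sigma>(k := i, k + 1 := w, k + 2 := v), t) \<in>
        sem (Seq (Op (Le (k + 1) (k + 2))) (Op (Le (k + 2) (k + 1)))) \<longleftrightarrow>
      t = int \<circ> \<sigma>(k := i, k + 1 := w, k + 2 := v) \<and> w = v" for w v t
    by auto
  have c': "(int \<circ> \<sigma>(k := i, k + 1 := w, k + 2 := v), t) \<in> sem (clear (k + 3) (k + 2)) \<longleftrightarrow>
      t = int \<circ> \<sigma>(k := i, k + 1 := w)" for w v t
    using sem_clear[of "\<sigma>(k := i, k + 1 := w, k + 2 := v)" "k + 3" "k + 2"] z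
      fun_upd_idem[of "\<sigma>(k := i, k + 1 := w)" "k + 2" 0]
    by simp
  have i: "(int \<circ> \<sigma>(k := i, k + 1 := w), t) \<in> sem (Op (Inc k)) \<longleftrightarrow>
      t = int \<circ> \<sigma>(k := Suc i, k + 1 := w)" for w t
  proof -
    have "(int \<circ> \<sigma>(k := i, k + 1 := w))(k := (int \<circ> \<sigma>(k := i, k + 1 := w)) k + 1) =
        int \<circ> \<sigma>(k := Suc i, k + 1 := w)"
      by (rule ext) simp
    thus ?thesis by (simp only: sem.simps instr_sem_simps)
  qed
  show ?thesis
    unfolding loop_body_def sem_Seq_guess[OF g] sem_Seq_test[OF p] sem_Seq_assign[OF c]
      sem_Seq_guess[OF g'] sem_Seq_test[OF e] sem_Seq_assign[OF c'] i
    by blast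
qed

lemma sem_Star_loop_body:
  assumes P: "is_test (k + 3) P
      (\<lambda>\<sigma>. R (\<sigma>(k := 0, k + 1 := 0, k + 2 := 0)) (\<sigma> k) (\<sigma> (k + 1)) (\<sigma> (k + 2)))"
    and z: "\<forall>x\<ge>k. \<sigma> x = 0"
  shows "(\<exists>y. I y \<and> (int \<circ> \<sigma>(k := 0, k + 1 := y), t) \<in> sem (Star (loop_body k P))) \<longleftrightarrow>
    (\<exists>i y. loop_reach I (R \<sigma>) i y \<and> t = int \<circ> \<sigma>(k := i, k + 1 := y))"
    (is "?l \<longleftrightarrow> ?r")
proof
  assume ?l
  then obtain y where "I y" "(int \<circ> \<sigma>(k := 0, k + 1 := y), t) \<in> (sem (loop_body k P))\<^sup>*"
    by auto
  from this(2,1) show ?r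
  proof (induction rule: rtrancl_induct)
    case base
    thus ?case by (blast intro: loop_reach.start)
  next
    case (step u t)
    then obtain i z where u: "loop_reach I (R \<sigma>) i z" "u = int \<circ> \<sigma>(k := i, k + 1 := z)"
      by blast
    with step(2) obtain y' where "R \<sigma> i z y'" "t = int \<circ> \<sigma>(k := Suc i, k + 1 := y')"
      using sem_loop_body[OF P z] by auto
    thus ?case using u(1) by (blast intro: loop_reach.step)
  qed
next
  assume ?r
  then obtain i y where "loop_reach I (R \<sigma>) i y" and t: "t = int \<circ> \<sigma>(k := i, k + 1 := y)"
    by blast
  from this(1) have "\<exists>z. I z \<and> (int \<circ> \<sigma>(k := 0, k + 1 := z), int \<circ> \<sigma>(k := i, k + 1 := y)) \<in>
      (sem (loop_body k P))\<^sup>*"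
  proof induction
    case (step n y z)
    have "(int \<circ> \<sigma>(k := n, k + 1 := y), int \<circ> \<sigma>(k := Suc n, k + 1 := z)) \<in> sem (loop_body k P)"
      using sem_loop_body[OF P z] step(2) by blast
    thus ?case using step.IH by (meson rtrancl.rtrancl_into_rtrancl)
  qed blast
  thus ?l using t by simp
qed

text \<open>The number of passes is left to nondeterminism; the final test \<open>P1\<close> keeps
  only the runs that stop at a suitable count and value. Primitive recursion and minimisation are
  both instances.\<close>

lemma is_test_loop:
  assumes P0: "is_test (k + 2) P0 (\<lambda>\<sigma>. I (\<sigma>(k + 1 := 0)) (\<sigma> (k + 1)))"
    and P: "is_test (k + 3) P
      (\<lambda>\<sigma>. R (\<sigma>(k := 0, k + 1 := 0, k + 2 := 0)) (\<sigma> k) (\<sigma> (k + 1)) (\<sigma> (k + 2)))"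
    and P1: "is_test (k + 2) P1 (\<lambda>\<sigma>. F (\<sigma>(k := 0, k + 1 := 0)) (\<sigma> k) (\<sigma> (k + 1)))"
  shows "is_test k (loop k P0 P P1)
    (\<lambda>\<sigma>. \<exists>n y. loop_reach (I \<sigma>) (R \<sigma>) n y \<and> F \<sigma> n y)"
  unfolding is_test_def
proof (intro allI impI)
  fix \<sigma> :: "nat \<Rightarrow> nat" and t
  assume z: "\<forall>x\<ge>k. \<sigma> x = 0"
  have id: "\<sigma>(k := 0) = \<sigma>" "\<sigma>(k + 1 := 0) = \<sigma>" "\<sigma>(k := 0, k + 1 := 0) = \<sigma>"
    using z by auto
  have g: "(int \<circ> \<sigma>, t) \<in> sem (Star (Op (Inc (k + 1)))) \<longleftrightarrow>
      (\<exists>v. t = int \<circ> \<sigma>(k := 0, k + 1 := v))" for t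
    using sem_guess[of \<sigma> "k + 1"] z id by simp
  have p0: "(int \<circ> \<sigma>(k := 0, k + 1 := v), t) \<in> sem P0 \<longleftrightarrow>
      t = int \<circ> \<sigma>(k := 0, k + 1 := v) \<and> I \<sigma> v" for v t
    using is_testD[OF P0, of "\<sigma>(k + 1 := v)" t] z id by simp
  have p1: "(int \<circ> \<sigma>(k := i, k + 1 := v), t) \<in> sem P1 \<longleftrightarrow>
      t = int \<circ> \<sigma>(k := i, k + 1 := v) \<and> F \<sigma> i v" for i v t
    using is_testD[OF P1, of "\<sigma>(k := i, k + 1 := v)" t] z id by (simp add: fun_upd_twist)
  have c: "(int \<circ> \<sigma>(k := i, k + 1 := y), t) \<in> sem (clear (k + 2) (k + 1)) \<longleftrightarrow>
      t = int \<circ> \<sigma>(k := i)" for i y t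
    using sem_clear[of "\<sigma>(k := i, k + 1 := y)" "k + 2" "k + 1"] z
      fun_upd_idem[of "\<sigma>(k := i)" "k + 1" 0] by simp
  have c': "(int \<circ> \<sigma>(k := i), t) \<in> sem (clear (k + 2) k) \<longleftrightarrow> t = int \<circ> \<sigma>" for i t
    using sem_clear[of "\<sigma>(k := i)" "k + 2" k] z id by simp
  have "(int \<circ> \<sigma>, t) \<in> sem (loop k P0 P P1) \<longleftrightarrow>
     (\<exists>u. (\<exists>y. I \<sigma> y \<and> (int \<circ> \<sigma>(k := 0, k + 1 := y), u) \<in> sem (Star (loop_body k P))) \<and>
       (u, t) \<in> sem (Seq P1 (Seq (clear (k + 2) (k + 1)) (clear (k + 2) k))))"
    unfolding loop_def sem_Seq_guess[OF g] sem_Seq_test[OF p0] by auto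
  also have "\<dots> \<longleftrightarrow> (\<exists>i y. loop_reach (I \<sigma>) (R \<sigma>) i y \<and>
     (int \<circ> \<sigma>(k := i, k + 1 := y), t) \<in> sem (Seq P1 (Seq (clear (k + 2) (k + 1)) (clear (k + 2) k))))"
    unfolding sem_Star_loop_body[OF P z] by blast
  also have "\<dots> \<longleftrightarrow> t = int \<circ> \<sigma> \<and> (\<exists>n y. loop_reach (I \<sigma>) (R \<sigma>) n y \<and> F \<sigma> n y)"
    unfolding sem_Seq_test[OF p1] sem_Seq_assign[OF c] c' by blast
  finally show "(int \<circ> \<sigma>, t) \<in> sem (loop k P0 P P1) \<longleftrightarrow>
     t = int \<circ> \<sigma> \<and> (\<exists>n y. loop_reach (I \<sigma>) (R \<sigma>) n y \<and> F \<sigma> n y)" .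
qed

section \<open>Testable graphs of recursive functions\<close>

definition testable :: "recf \<Rightarrow> bool" where
  "testable f \<longleftrightarrow> (\<forall>rs r k. (\<forall>x\<in>insert r (set rs). x < k) \<longrightarrow>
     (\<exists>P. is_test k P (\<lambda>\<sigma>. recf_eval f (map \<sigma> rs) (\<sigma> r))))"

lemma testableD:
  "testable f \<Longrightarrow> \<forall>x\<in>set rs. x < k \<Longrightarrow> r < k \<Longrightarrow>
     \<exists>P. is_test k P (\<lambda>\<sigma>. recf_eval f (map \<sigma> rs) (\<sigma> r))"
  by (simp add: testable_def)

inductive_cases recf_eval_Zero: "recf_eval Zero xs y"
inductive_cases recf_eval_Succ: "recf_eval Succ xs y"
inductive_cases recf_eval_Proj: "recf_eval (Proj i) xs y"
inductive_cases recf_eval_Comp: "recf_eval (Comp f gs) xs y"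
inductive_cases recf_eval_PrimRec_0: "recf_eval (PrimRec f g) (0 # xs) y"
inductive_cases recf_eval_PrimRec_Suc: "recf_eval (PrimRec f g) (Suc n # xs) y"
inductive_cases recf_eval_PrimRec_Nil: "recf_eval (PrimRec f g) [] y"
inductive_cases recf_eval_Mu: "recf_eval (Mu f) xs y"

lemma recf_eval_Comp_iff:
  "recf_eval (Comp f gs) xs y \<longleftrightarrow>
     (\<exists>ys. list_all2 (\<lambda>g y. recf_eval g xs y) gs ys \<and> recf_eval f ys y)"
  by (auto elim: recf_eval_Comp intro: recf_eval.Comp)

lemma map_fun_upd_fresh:
  fixes k :: nat
  assumes "\<forall>x\<in>set rs. x < k" "k \<le> l"
  shows "map (\<sigma>(l := v)) rs = map \<sigma> rs"
proof -
  have "l \<notin> set rs" using assms by (meson leD)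
  thus ?thesis by simp
qed

lemma testable_Zero: "testable Zero"
  unfolding testable_def
proof (intro allI impI)
  fix rs r k
  have "is_test k (Op (Le r k)) (\<lambda>\<sigma>. recf_eval Zero (map \<sigma> rs) (\<sigma> r))"
    by (rule is_test_cong[OF is_test_Le])
       (auto elim: recf_eval_Zero intro: recf_eval.Zero)
  thus "\<exists>P. is_test k P (\<lambda>\<sigma>. recf_eval Zero (map \<sigma> rs) (\<sigma> r))" by blast
qed

lemma testable_Succ: "testable Succ"
  unfolding testable_def
proof (intro allI impI)
  fix rs :: "nat list" and r k :: nat
  assume *: "\<forall>x\<in>insert r (set rs). x < k"
  show "\<exists>P. is_test k P (\<lambda>\<sigma>. recf_eval Succ (map \<sigma> rs) (\<sigma> r))"
  proof (cases "\<exists>a. rs = [a]")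
    case True
    then obtain a where a: "rs = [a]" by blast
    \<comment> \<open>The argument is first copied to the fresh register \<open>k\<close>, because
      \<open>a\<close> and \<open>r\<close> may coincide, which \<open>is_test_Suc\<close>
      excludes.\<close>
    have "k \<noteq> r" using * by auto
    note T = is_test_ex[OF is_test_Seq[OF is_test_eq[of _ k a] is_test_Suc[OF this]]]
    have "Suc (\<sigma> a) = \<sigma> r \<longleftrightarrow> recf_eval Succ [\<sigma> a] (\<sigma> r)" for \<sigma>
      by (metis recf_eval.Succ recf_eval_Succ list.inject)
    hence iff: "(\<exists>v. (\<sigma>(k := v)) k = (\<sigma>(k := v)) a \<and> Suc ((\<sigma>(k := v)) k) = (\<sigma>(k := v)) r) \<longleftrightarrow>
      recf_eval Succ (map \<sigma> rs) (\<sigma> r)" for \<sigma>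
      using * a by auto
    show ?thesis by (rule exI, rule is_test_cong[OF T]) (rule iff)
  next
    case False
    hence "\<not> recf_eval Succ (map \<sigma> rs) (\<sigma> r)" for \<sigma>
      by (auto elim!: recf_eval_Succ)
    thus ?thesis by (rule ex_test_False)
  qed
qed

lemma testable_Proj: "testable (Proj i)"
  unfolding testable_def
proof (intro allI impI)
  fix rs :: "nat list" and r k :: nat
  show "\<exists>P. is_test k P (\<lambda>\<sigma>. recf_eval (Proj i) (map \<sigma> rs) (\<sigma> r))"
  proof (cases "i < length rs")
    case True
    have "recf_eval (Proj i) (map \<sigma> rs) (\<sigma> (rs ! i))" for \<sigma>
      using True recf_eval.Proj[of i "map \<sigma> rs"] by simp
    hence "recf_eval (Proj i) (map \<sigma> rs) y \<longleftrightarrow> y = \<sigma> (rs ! i)" for \<sigma> y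
      using recf_eval_deterministic by blast
    hence "is_test k (Seq (Op (Le r (rs ! i))) (Op (Le (rs ! i) r)))
        (\<lambda>\<sigma>. recf_eval (Proj i) (map \<sigma> rs) (\<sigma> r))"
      by (intro is_test_cong[OF is_test_eq]) auto
    thus ?thesis by blast
  next
    case False
    hence "\<not> recf_eval (Proj i) (map \<sigma> rs) (\<sigma> r)" for \<sigma>
      by (auto elim!: recf_eval_Proj)
    thus ?thesis by (rule ex_test_False)
  qed
qed

lemma testable_Comp:
  assumes f: "testable f" and gs: "\<And>g. g \<in> set gs \<Longrightarrow> testable g"
  shows "testable (Comp f gs)"
  unfolding testable_def
proof (intro allI impI)
  fix rs :: "nat list" and r k :: nat
  assume *: "\<forall>x\<in>insert r (set rs). x < k"
  have "\<exists>P. is_test k P (\<lambda>\<sigma>. \<exists>ys. list_all2 (\<lambda>g y. recf_eval g (map \<sigma> rs) y) gs ys \<and>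
      recf_eval f (map \<sigma> acc @ ys) (\<sigma> r))"
    if "\<forall>x\<in>insert r (set rs \<union> set acc). x < k" for acc
    using gs that
  proof (induction gs arbitrary: acc k)
    case Nil
    thus ?case using testableD[OF f, of acc k r] by auto
  next
    case (Cons g gs)
    obtain Pg where Pg: "is_test (Suc k) Pg (\<lambda>\<sigma>. recf_eval g (map \<sigma> rs) (\<sigma> k))"
      using testableD[of g rs "Suc k" k] Cons.prems by (auto simp: less_Suc_eq)
    have "\<exists>P. is_test (Suc k) P (\<lambda>\<sigma>. \<exists>ys. list_all2 (\<lambda>g y. recf_eval g (map \<sigma> rs) y) gs ys \<and>
        recf_eval f (map \<sigma> (acc @ [k]) @ ys) (\<sigma> r))"
      by (rule Cons.IH) (use Cons.prems in \<open>auto simp: less_Suc_eq\<close>)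
    then obtain P where P: "is_test (Suc k) P (\<lambda>\<sigma>. \<exists>ys.
        list_all2 (\<lambda>g y. recf_eval g (map \<sigma> rs) y) gs ys \<and>
        recf_eval f (map \<sigma> (acc @ [k]) @ ys) (\<sigma> r))" by blast
    have m: "map (\<sigma>(k := v)) rs = map \<sigma> rs" "map (\<sigma>(k := v)) acc = map \<sigma> acc" "(\<sigma>(k := v)) r = \<sigma> r"
      for \<sigma> :: "nat \<Rightarrow> nat" and v
      using Cons.prems(2) by (auto intro!: map_cong)
    show ?case
      by (rule exI, rule is_test_cong[OF is_test_ex[OF is_test_Seq[OF Pg P]]])
         (auto simp: m list_all2_Cons1 simp del: fun_upd_apply map_fun_upd, auto simp: m)
  qed
  from this[of "[]"] obtain P where
    "is_test k P (\<lambda>\<sigma>. \<exists>ys. list_all2 (\<lambda>g y. recf_eval g (map \<sigma> rs) y) gs ys \<and>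
      recf_eval f ys (\<sigma> r))" using * by auto
  thus "\<exists>P. is_test k P (\<lambda>\<sigma>. recf_eval (Comp f gs) (map \<sigma> rs) (\<sigma> r))"
    unfolding recf_eval_Comp_iff by blast
qed

lemma loop_reach_PrimRec:
  "loop_reach (recf_eval f xs) (\<lambda>n y. recf_eval g (n # y # xs)) n y \<longleftrightarrow>
    recf_eval (PrimRec f g) (n # xs) y"
proof
  assume "recf_eval (PrimRec f g) (n # xs) y"
  thus "loop_reach (recf_eval f xs) (\<lambda>n y. recf_eval g (n # y # xs)) n y"
  proof (induction n arbitrary: y)
    case 0
    thus ?case by (rule recf_eval_PrimRec_0) (rule loop_reach.start)
  next
    case (Suc n)
    from Suc.prems show ?case
      by (rule recf_eval_PrimRec_Suc) (rule loop_reach.step[OF Suc.IH])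
  qed
next
  assume "loop_reach (recf_eval f xs) (\<lambda>n y. recf_eval g (n # y # xs)) n y"
  thus "recf_eval (PrimRec f g) (n # xs) y"
  proof induction
    case (start y)
    thus ?case by (rule recf_eval.PrimRec_0)
  next
    case (step n y z)
    from step.IH step.hyps(2) show ?case by (rule recf_eval.PrimRec_Suc)
  qed
qed

lemma testable_PrimRec:
  assumes f: "testable f" and g: "testable g"
  shows "testable (PrimRec f g)"
  unfolding testable_def
proof (intro allI impI)
  fix rs :: "nat list" and r k :: nat
  assume *: "\<forall>x\<in>insert r (set rs). x < k"
  show "\<exists>P. is_test k P (\<lambda>\<sigma>. recf_eval (PrimRec f g) (map \<sigma> rs) (\<sigma> r))"
  proof (cases rs)
    case Nil
    hence "\<not> recf_eval (PrimRec f g) (map \<sigma> rs) (\<sigma> r)" for \<sigma>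
      by (auto elim!: recf_eval_PrimRec_Nil)
    thus ?thesis by (rule ex_test_False)
  next
    case (Cons c rs')
    have c: "c < k" "r < k" "\<forall>x\<in>set rs'. x < k" using * Cons by auto
    have m: "map (\<sigma>(l := v)) rs' = map \<sigma> rs'" if "l \<ge> k" for \<sigma> :: "nat \<Rightarrow> nat" and v l
      using c(3) that by (rule map_fun_upd_fresh)
    have lt: "\<forall>x\<in>set rs'. x < k + 2" "\<forall>x\<in>set (k # (k + 1) # rs'). x < k + 3"
      using c(3) by fastforce+
    obtain P0 where P0: "is_test (k + 2) P0 (\<lambda>\<sigma>. recf_eval f (map \<sigma> rs') (\<sigma> (k + 1)))"
      by (rule exE[OF testableD[OF f lt(1), of "k + 1"]]) simp_all
    obtain P where P: "is_test (k + 3) P (\<lambda>\<sigma>. recf_eval g (map \<sigma> (k # (k + 1) # rs')) (\<sigma> (k + 2)))"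
      by (rule exE[OF testableD[OF g lt(2), of "k + 2"]]) simp_all
    \<comment> \<open>The final test demands that the loop stops after as many passes as the first
      argument says, with the value of register \<open>r\<close>.\<close>
    have T: "is_test k (loop k P0 P
      (Seq (Seq (Op (Le k c)) (Op (Le c k))) (Seq (Op (Le (k + 1) r)) (Op (Le r (k + 1))))))
      (\<lambda>\<sigma>. \<exists>n y. loop_reach (recf_eval f (map \<sigma> rs')) (\<lambda>n y. recf_eval g (n # y # map \<sigma> rs')) n y \<and>
        n = \<sigma> c \<and> y = \<sigma> r)"
    proof (rule is_test_loop[where I = "\<lambda>\<sigma>. recf_eval f (map \<sigma> rs')" and
          R = "\<lambda>\<sigma> n y. recf_eval g (n # y # map \<sigma> rs')" and F = "\<lambda>\<sigma> n y. n = \<sigma> c \<and> y = \<sigma> r"])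
      show "is_test (k + 2) P0 (\<lambda>\<sigma>. recf_eval f (map (\<sigma>(k + 1 := 0)) rs') (\<sigma> (k + 1)))"
        by (rule is_test_cong[OF P0]) (simp add: m)
      show "is_test (k + 3) P (\<lambda>\<sigma>. recf_eval g (\<sigma> k # \<sigma> (k + 1) #
          map (\<sigma>(k := 0, k + 1 := 0, k + 2 := 0)) rs') (\<sigma> (k + 2)))"
        by (rule is_test_cong[OF P]) (simp add: m)
    qed (rule is_test_cong[OF is_test_Seq[OF is_test_eq is_test_eq]], use c in simp)
    have "(\<exists>n y. loop_reach (recf_eval f (map \<sigma> rs')) (\<lambda>n y. recf_eval g (n # y # map \<sigma> rs')) n y \<and>
        n = \<sigma> c \<and> y = \<sigma> r) \<longleftrightarrow> recf_eval (PrimRec f g) (map \<sigma> rs) (\<sigma> r)" for \<sigma>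
      by (simp add: loop_reach_PrimRec Cons)
    thus ?thesis
      by - (rule exI, rule is_test_cong[OF T])
  qed
qed

text \<open>For minimisation the loop carries the predecessor of the last value of \<open>f\<close>,
  hence a witness that this value is positive; the start value 0 is a placeholder.\<close>

lemma loop_reach_Mu:
  "loop_reach (\<lambda>y. y = 0) (\<lambda>n _ y. recf_eval f (n # xs) (Suc y)) n y \<Longrightarrow>
    \<forall>i<n. \<exists>y. recf_eval f (i # xs) (Suc y)"
  by (induction rule: loop_reach.induct) (auto simp: less_Suc_eq)

lemma loop_reach_MuI:
  "\<forall>i<n. \<exists>y. recf_eval f (i # xs) (Suc y) \<Longrightarrow>
    \<exists>y. loop_reach (\<lambda>y. y = 0) (\<lambda>n _ y. recf_eval f (n # xs) (Suc y)) n y"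
proof (induction n)
  case 0
  show ?case by (rule exI, rule loop_reach.start, rule refl)
next
  case (Suc n)
  then obtain y where y: "loop_reach (\<lambda>y. y = 0) (\<lambda>n _ y. recf_eval f (n # xs) (Suc y)) n y"
    by auto
  obtain z where "recf_eval f (n # xs) (Suc z)"
    using Suc.prems by auto
  thus ?case by - (rule exI, rule loop_reach.step[OF y])
qed

lemma testable_Mu:
  assumes f: "testable f"
  shows "testable (Mu f)"
  unfolding testable_def
proof (intro allI impI)
  fix rs :: "nat list" and r k :: nat
  assume *: "\<forall>x\<in>insert r (set rs). x < k"
  have m: "map (\<sigma>(l := v)) rs = map \<sigma> rs" if "l \<ge> k" for \<sigma> :: "nat \<Rightarrow> nat" and v l
    using _ that by (rule map_fun_upd_fresh) (use * in auto)
  have P0: "is_test (k + 2) (Op (Le (k + 1) (k + 2))) (\<lambda>\<sigma>. \<sigma> (k + 1) = 0)"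
    by (rule is_test_cong[OF is_test_Le]) auto
  have ne: "k + 2 \<noteq> k + 3" by simp
  have lt: "\<forall>x\<in>set (k # rs). x < k + 3" "\<forall>x\<in>set (k # rs). x < k + 4"
    using * by fastforce+
  obtain P where P: "is_test (k + 4) P (\<lambda>\<sigma>. recf_eval f (map \<sigma> (k # rs)) (\<sigma> (k + 3)))"
    using testableD[OF f lt(2), of "k + 3"] by auto
  \<comment> \<open>The successor is guessed in register \<open>k + 3\<close>, because
    \<open>testable\<close> speaks only of values held in registers.\<close>
  have P': "\<exists>P. is_test (k + 3) P (\<lambda>\<sigma>. recf_eval f (map \<sigma> (k # rs)) (Suc (\<sigma> (k + 2))))"
  proof -
    have "is_test (Suc (k + 3)) P (\<lambda>\<sigma>. recf_eval f (map \<sigma> (k # rs)) (\<sigma> (k + 3)))"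
      using P by (simp add: eval_nat_numeral)
    note T = is_test_ex[OF is_test_Seq[OF is_test_Suc[OF ne] this]]
    show ?thesis
      by (rule exI, rule is_test_cong[OF T]) (auto simp: m)
  qed
  then obtain P' where P': "is_test (k + 3) P' (\<lambda>\<sigma>. recf_eval f (map \<sigma> (k # rs)) (Suc (\<sigma> (k + 2))))"
    by blast
  obtain P1 where P1: "is_test (k + 3) P1 (\<lambda>\<sigma>. recf_eval f (map \<sigma> (k # rs)) (\<sigma> (k + 2)))"
    using testableD[OF f lt(1), of "k + 2"] by auto
  have P1: "is_test (k + 2) P1 (\<lambda>\<sigma>. recf_eval f (map \<sigma> (k # rs)) 0)"
    by (rule is_test_cong[OF is_test_mono[OF P1]]) auto
  have T: "is_test k (loop k (Op (Le (k + 1) (k + 2))) P' (Seq P1 (Seq (Op (Le k r)) (Op (Le r k)))))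
    (\<lambda>\<sigma>. \<exists>n y. loop_reach (\<lambda>y. y = 0) (\<lambda>n _ y. recf_eval f (n # map \<sigma> rs) (Suc y)) n y \<and>
      (recf_eval f (n # map \<sigma> rs) 0 \<and> n = \<sigma> r))"
  proof (rule is_test_loop[where I = "\<lambda>\<sigma> y. y = 0" and
      R = "\<lambda>\<sigma> n _ y. recf_eval f (n # map \<sigma> rs) (Suc y)" and
      F = "\<lambda>\<sigma> n _. recf_eval f (n # map \<sigma> rs) 0 \<and> n = \<sigma> r"])
    show "is_test (k + 2) (Op (Le (k + 1) (k + 2))) (\<lambda>\<sigma>. \<sigma> (k + 1) = 0)"
      by (rule P0)
    show "is_test (k + 3) P' (\<lambda>\<sigma>. recf_eval f (\<sigma> k #
        map (\<sigma>(k := 0, k + 1 := 0, k + 2 := 0)) rs) (Suc (\<sigma> (k + 2))))"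
      by (rule is_test_cong[OF P']) (simp add: m)
  qed (rule is_test_cong[OF is_test_Seq[OF P1 is_test_eq]], use * in \<open>auto simp: m\<close>)
  have "(\<exists>n y. loop_reach (\<lambda>y. y = 0) (\<lambda>n _ y. recf_eval f (n # xs) (Suc y)) n y \<and>
      (recf_eval f (n # xs) 0 \<and> n = v)) \<longleftrightarrow> recf_eval (Mu f) xs v" for xs v
  proof
    assume "recf_eval (Mu f) xs v"
    thus "\<exists>n y. loop_reach (\<lambda>y. y = 0) (\<lambda>n _ y. recf_eval f (n # xs) (Suc y)) n y \<and>
      (recf_eval f (n # xs) 0 \<and> n = v)"
      by (rule recf_eval_Mu) (use loop_reach_MuI in blast)
  qed (auto dest: loop_reach_Mu intro: recf_eval.Mu)
  thus "\<exists>P. is_test k P (\<lambda>\<sigma>. recf_eval (Mu f) (map \<sigma> rs) (\<sigma> r))"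
    by - (rule exI, rule is_test_cong[OF T])
qed

lemma testable: "testable f"
  by (induction f)
     (simp_all add: testable_Zero testable_Succ testable_Proj testable_Comp testable_PrimRec testable_Mu)


section \<open>The automata of a flow graph\<close>

text \<open>\<open>Track p\<close> follows the control flow and ends in \<open>Bad\<close> on an error. \<open>Compare a b\<close> keeps the
  ratio \<open>2 ^ (r\<^sub>a - r\<^sub>b)\<close>, up to its value for the input, until it guesses a failing test and freezes
  the ratio in \<open>Frozen k\<close>. There \<open>k\<close> determines the payment that makes up for the input, which is in
  register 0: \<open>- 1\<close>, \<open>- 2 ^ n\<close> or \<open>- 1 / 2 ^ n\<close>. The letter \<open>None\<close> is the end mark.\<close>

datatype ctrl = Sink | Bad | Frozen nat | Compare nat nat | Track nat

instance ctrl :: countable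
  by countable_datatype

text \<open>Only register 0 starts with the input, so the initial difference of the registers
  \<open>a\<close> and \<open>b\<close> is 0, n or -n; the codes are 0, 1, 2 in this order.\<close>

definition input_sign :: "nat \<Rightarrow> nat \<Rightarrow> nat" where
  "input_sign a b = (if (a = 0) = (b = 0) then 0 else if a = 0 then 1 else 2)"

fun succs :: "ctrl \<Rightarrow> edge option \<Rightarrow> ctrl set" where
  "succs q None = {Sink}"
| "succs (Track p) (Some (u, c, v)) = {if p = u then Track v else Bad}"
| "succs (Compare a b) (Some (u, c, v)) =
     insert (Compare a b) (if c = Le a b then {Frozen (input_sign a b)} else {})"
| "succs q (Some e) = {q}"

text \<open>An end mark read in \<open>Compare\<close> has weight 0, so a run that never claims a
  failing test cannot undercut the deterministic automaton.\<close>

fun ctrl_weight :: "nat \<Rightarrow> nat \<Rightarrow> ctrl \<Rightarrow> edge option \<Rightarrow> rat" where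
  "ctrl_weight f n (Track p) None = (if p = f then 0 else - 2)"
| "ctrl_weight f n Bad None = - 2"
| "ctrl_weight f n (Frozen k) None = (if k = 1 then - (2 ^ n) else if k = 2 then - (1 / 2 ^ n) else - 1)"
| "ctrl_weight f n q x = 0"

text \<open>For \<open>a \<noteq> b\<close> the factor 2 belongs to \<open>Inc a\<close> and
  \<open>Dec b\<close>, the factor 8 to \<open>Dec a\<close> and \<open>Inc b\<close>; for
  \<open>a = b\<close> the factor is always 4.\<close>

fun ctrl_discount :: "ctrl \<Rightarrow> edge option \<Rightarrow> rat" where
  "ctrl_discount (Compare a b) (Some (u, c, v)) =
     (if effect c a = effect c b then 4 else if effect c b < effect c a then 2 else 8)"
| "ctrl_discount q x = 4"

definition letters :: "edge set \<Rightarrow> edge option set" where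
  "letters E = insert None (Some ` E)"

definition ctrl_nmda :: "edge set \<Rightarrow> ctrl set \<Rightarrow> ctrl set \<Rightarrow> nat \<Rightarrow> nat \<Rightarrow> (nat, nat) nmda" where
  "ctrl_nmda E S I f n = \<lparr>alphabet = to_nat ` letters E, states = to_nat ` S, initial = to_nat ` I,
     transitions = {(to_nat p, to_nat x, to_nat q) |p x q. p \<in> S \<and> x \<in> letters E \<and> q \<in> succs p x},
     weight = (\<lambda>(p, x, q). ctrl_weight f n (from_nat p) (from_nat x)),
     discount = (\<lambda>(p, x, q). ctrl_discount (from_nat p) (from_nat x))\<rparr>"

lemma ctrl_nmda_simps [simp]:
  "alphabet (ctrl_nmda E S I f n) = to_nat ` letters E"
  "states (ctrl_nmda E S I f n) = to_nat ` S"
  "initial (ctrl_nmda E S I f n) = to_nat ` I"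
  "weight (ctrl_nmda E S I f n) (to_nat p, to_nat x, q) = ctrl_weight f n p x"
  "discount (ctrl_nmda E S I f n) (to_nat p, to_nat x, q) = ctrl_discount p x"
  by (simp_all add: ctrl_nmda_def)

lemma transitions_ctrl_nmda:
  "(to_nat p, to_nat x, to_nat q) \<in> transitions (ctrl_nmda E S I f n) \<longleftrightarrow>
     p \<in> S \<and> x \<in> letters E \<and> q \<in> succs p x"
  by (auto simp: ctrl_nmda_def)

lemma in_transitions_ctrl_nmdaE:
  assumes "t \<in> transitions (ctrl_nmda E S I f n)"
  obtains p x q where "t = (to_nat p, to_nat x, to_nat q)" "p \<in> S" "x \<in> letters E" "q \<in> succs p x"
  using assms by (auto simp: ctrl_nmda_def)

lemma succs_nonempty: "succs p x \<noteq> {}"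
  by (cases "(p, x)" rule: succs.cases) auto

lemma ctrl_discount_range: "ctrl_discount p x \<in> {2, 4, 8}"
  by (cases "(p, x)" rule: ctrl_discount.cases) auto

lemma is_nmda_ctrl_nmda:
  assumes "finite E" "finite S" "I \<subseteq> S" and closed: "\<And>p x. p \<in> S \<Longrightarrow> x \<in> letters E \<Longrightarrow> succs p x \<subseteq> S"
  shows "is_nmda (ctrl_nmda E S I f n)" "is_integral (ctrl_nmda E S I f n)"
proof -
  have d: "discount (ctrl_nmda E S I f n) t \<in> {2, 4, 8}" if "t \<in> transitions (ctrl_nmda E S I f n)" for t
    using that ctrl_discount_range by (elim in_transitions_ctrl_nmdaE) auto
  show "is_integral (ctrl_nmda E S I f n)"
    unfolding is_integral_def using d by (auto dest!: d)
  have "\<exists>q. (p, a, q) \<in> transitions (ctrl_nmda E S I f n)"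
    if pa: "p \<in> to_nat ` S" "a \<in> to_nat ` letters E" for p a
  proof -
    obtain p' x where "p = to_nat p'" "p' \<in> S" "a = to_nat x" "x \<in> letters E"
      using pa by auto
    moreover obtain q where "q \<in> succs p' x"
      using succs_nonempty by blast
    ultimately show ?thesis
      using transitions_ctrl_nmda by blast
  qed
  moreover have "transitions (ctrl_nmda E S I f n) \<subseteq> to_nat ` S \<times> to_nat ` letters E \<times> to_nat ` S"
  proof
    fix t assume "t \<in> transitions (ctrl_nmda E S I f n)"
    thus "t \<in> to_nat ` S \<times> to_nat ` letters E \<times> to_nat ` S"
      by (rule in_transitions_ctrl_nmdaE) (use closed in blast)
  qed
  moreover have "discount (ctrl_nmda E S I f n) t > 1" if "t \<in> transitions (ctrl_nmda E S I f n)" for t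
    using d[OF that] by auto
  ultimately show "is_nmda (ctrl_nmda E S I f n)"
    unfolding is_nmda_def using assms(1-3) by (simp add: letters_def image_mono)
qed

lemma words_ctrl_nmda:
  assumes "w \<in> words (alphabet (ctrl_nmda E S I f n))"
  shows "\<exists>\<omega>. w = to_nat \<circ> \<omega> \<and> (\<forall>i. \<omega> i \<in> letters E)"
proof -
  have "\<forall>i. \<exists>x. w i = to_nat x \<and> x \<in> letters E"
    using assms by (auto simp: words_def)
  then obtain \<omega> where "\<forall>i. w i = to_nat (\<omega> i) \<and> \<omega> i \<in> letters E"
    by metis
  thus ?thesis by (auto simp: fun_eq_iff)
qed

section \<open>Runs and values in terms of control states\<close>

definition is_run :: "ctrl set \<Rightarrow> (nat \<Rightarrow> edge option) \<Rightarrow> (nat \<Rightarrow> ctrl) \<Rightarrow> bool" where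
  "is_run I \<omega> \<rho> \<longleftrightarrow> \<rho> 0 \<in> I \<and> (\<forall>i. \<rho> (Suc i) \<in> succs (\<rho> i) (\<omega> i))"

definition ctrl_value :: "nat \<Rightarrow> nat \<Rightarrow> (nat \<Rightarrow> edge option) \<Rightarrow> (nat \<Rightarrow> ctrl) \<Rightarrow> real" where
  "ctrl_value f n \<omega> \<rho> =
     (\<Sum>i. of_rat (ctrl_weight f n (\<rho> i) (\<omega> i)) * (\<Prod>j<i. 1 / of_rat (ctrl_discount (\<rho> j) (\<omega> j))))"

text \<open>\<open>is_run\<close> does not mention the state set; that a run stays in
  \<open>S\<close> follows from the closure of \<open>S\<close> under successors.\<close>

lemma runs_ctrl_nmda:
  assumes "I \<subseteq> S" "\<And>p x. p \<in> S \<Longrightarrow> x \<in> letters E \<Longrightarrow> succs p x \<subseteq> S" "\<And>i. \<omega> i \<in> letters E"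
  shows "runs (ctrl_nmda E S I f n) (to_nat \<circ> \<omega>) = (\<lambda>\<rho>. to_nat \<circ> \<rho>) ` {\<rho>. is_run I \<omega> \<rho>}"
proof (intro equalityI subsetI)
  fix r assume r: "r \<in> runs (ctrl_nmda E S I f n) (to_nat \<circ> \<omega>)"
  define \<rho> :: "nat \<Rightarrow> ctrl" where "\<rho> i = from_nat (r i)" for i
  have t: "(r i, to_nat (\<omega> i), r (Suc i)) \<in> transitions (ctrl_nmda E S I f n)" for i
    using r by (auto simp: runs_def step_def)
  have \<rho>: "r i = to_nat (\<rho> i)" for i
    using t[of i] by (elim in_transitions_ctrl_nmdaE) (simp add: \<rho>_def)
  have "is_run I \<omega> \<rho>"
    using t r unfolding is_run_def \<rho> transitions_ctrl_nmda by (auto simp: runs_def \<rho>)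
  moreover have "r = to_nat \<circ> \<rho>"
    using \<rho> by auto
  ultimately show "r \<in> (\<lambda>\<rho>. to_nat \<circ> \<rho>) ` {\<rho>. is_run I \<omega> \<rho>}"
    by blast
next
  fix r assume "r \<in> (\<lambda>\<rho>. to_nat \<circ> \<rho>) ` {\<rho>. is_run I \<omega> \<rho>}"
  then obtain \<rho> where \<rho>: "is_run I \<omega> \<rho>" "r = to_nat \<circ> \<rho>"
    by blast
  have "\<rho> i \<in> S" for i
    using \<rho>(1) assms by (induction i) (auto simp: is_run_def, blast)
  thus "r \<in> runs (ctrl_nmda E S I f n) (to_nat \<circ> \<omega>)"
    using \<rho> assms by (auto simp: runs_def step_def transitions_ctrl_nmda is_run_def)
qed

lemma nmda_value_ctrl_nmda:
  assumes "I \<subseteq> S" "\<And>p x. p \<in> S \<Longrightarrow> x \<in> letters E \<Longrightarrow> succs p x \<subseteq> S" "\<And>i. \<omega> i \<in> letters E"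
  shows "nmda_value (ctrl_nmda E S I f n) (to_nat \<circ> \<omega>) =
    (INF \<rho>\<in>{\<rho>. is_run I \<omega> \<rho>}. ereal (ctrl_value f n \<omega> \<rho>))"
proof -
  have "runs (ctrl_nmda E S I f n) (to_nat \<circ> \<omega>) = (\<lambda>\<rho>. to_nat \<circ> \<rho>) ` {\<rho>. is_run I \<omega> \<rho>}"
    by (rule runs_ctrl_nmda) (use assms in auto)
  moreover have "run_value (ctrl_nmda E S I f n) (to_nat \<circ> \<omega>) (to_nat \<circ> \<rho>) = ctrl_value f n \<omega> \<rho>" for \<rho>
    by (simp add: run_value_def step_def ctrl_value_def)
  ultimately show ?thesis
    by (simp only: nmda_value_def image_image)
qed

definition first_end :: "(nat \<Rightarrow> edge option) \<Rightarrow> nat \<Rightarrow> bool" where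
  "first_end \<omega> m \<longleftrightarrow> \<omega> m = None \<and> (\<forall>i<m. \<omega> i \<noteq> None)"

lemma ctrl_weight_Some [simp]: "ctrl_weight f n q (Some e) = 0"
  by (cases q) auto

lemma ctrl_value_no_end:
  assumes "\<forall>i. \<omega> i \<noteq> None"
  shows "ctrl_value f n \<omega> \<rho> = 0"
proof -
  have "ctrl_weight f n (\<rho> i) (\<omega> i) = 0" for i
    using assms by (metis not_None_eq ctrl_weight_Some)
  thus ?thesis by (simp add: ctrl_value_def)
qed

text \<open>Edges have weight 0, and the first end mark leads to \<open>Sink\<close>, where every
  later letter has weight 0; a single summand survives.\<close>

lemma ctrl_value_first_end:
  assumes "is_run I \<omega> \<rho>" "first_end \<omega> m"
  shows "ctrl_value f n \<omega> \<rho> = of_rat (ctrl_weight f n (\<rho> m) None) *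
    (\<Prod>j<m. 1 / of_rat (ctrl_discount (\<rho> j) (\<omega> j)))"
proof -
  have step: "\<rho> (Suc i) \<in> succs (\<rho> i) (\<omega> i)" for i
    using assms by (simp add: is_run_def)
  have sink: "\<rho> (Suc m + i) = Sink" for i
  proof (induction i)
    case 0
    show ?case using step[of m] assms(2) by (simp add: first_end_def)
  next
    case (Suc i)
    thus ?case using step[of "Suc m + i"] by (cases "\<omega> (Suc m + i)") auto
  qed
  have "ctrl_weight f n (\<rho> i) (\<omega> i) = 0" if "i \<noteq> m" for i
  proof (cases "i < m")
    case True
    thus ?thesis using assms(2) by (auto simp: first_end_def)
  next
    case False
    with that obtain j where "i = Suc m + j" by (metis less_iff_Suc_add nat_neq_iff add_Suc)
    thus ?thesis using sink[of j] by simp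
  qed
  hence "ctrl_value f n \<omega> \<rho> =
    (\<Sum>i\<in>{m}. of_rat (ctrl_weight f n (\<rho> i) (\<omega> i)) * (\<Prod>j<i. 1 / of_rat (ctrl_discount (\<rho> j) (\<omega> j))))"
    unfolding ctrl_value_def by (intro suminf_finite) auto
  thus ?thesis using assms(2) by (simp add: first_end_def)
qed

section \<open>The two automata and the value of the deterministic one\<close>

definition tests :: "edge set \<Rightarrow> ctrl set" where
  "tests E = {Compare a b |a b. \<exists>u v. (u, Le a b, v) \<in> E}"

text \<open>All three \<open>Frozen\<close> states are present for every graph, so the two
  transitions whose weights depend on the input exist even if no test leads to them.\<close>

definition nmda_states :: "edge set \<Rightarrow> nat \<Rightarrow> ctrl set" where
  "nmda_states E i = {Sink, Bad, Track i} \<union> Frozen ` {0, 1, 2} \<union> tests E \<union> (\<lambda>(u, c, v). Track v) ` E"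

definition nmda_of :: "edge set \<Rightarrow> nat \<Rightarrow> nat \<Rightarrow> nat \<Rightarrow> (nat, nat) nmda" where
  "nmda_of E i f n = ctrl_nmda E (nmda_states E i) (insert (Track i) (tests E)) f n"

text \<open>The initial state is the error state: after a control error the nondeterministic
  automaton continues in the same way, having used the factor 4 throughout.\<close>

definition dmda_of :: "edge set \<Rightarrow> (nat, nat) nmda" where
  "dmda_of E = ctrl_nmda E {Bad, Sink} {Bad} 0 0"

lemma finite_tests: "finite E \<Longrightarrow> finite (tests E)"
proof -
  assume "finite E"
  moreover have "tests E \<subseteq> (\<lambda>(u, c, v). case c of Le a b \<Rightarrow> Compare a b | _ \<Rightarrow> Sink) ` E"
    by (force simp: tests_def image_iff)
  ultimately show ?thesis
    by (meson finite_imageI finite_subset)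
qed

lemma succs_dmda: "p \<in> {Bad, Sink} \<Longrightarrow> succs p x \<subseteq> {Bad, Sink}"
  by (cases "(p, x)" rule: succs.cases) auto

lemma input_sign_range: "input_sign a b \<in> {0, 1, 2}"
  by (simp add: input_sign_def)

lemma succs_nmda: "p \<in> nmda_states E i \<Longrightarrow> x \<in> letters E \<Longrightarrow> succs p x \<subseteq> nmda_states E i"
proof (cases x)
  case (Some e)
  moreover assume p: "p \<in> nmda_states E i" and "x \<in> letters E"
  moreover obtain u c v where e: "e = (u, c, v)"
    by (metis surj_pair)
  ultimately have "Track v \<in> nmda_states E i"
    by (force simp: nmda_states_def letters_def)
  moreover have "Frozen (input_sign a b) \<in> nmda_states E i" for a b
    using input_sign_range[of a b] by (auto simp: nmda_states_def)
  moreover have "Bad \<in> nmda_states E i"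
    by (simp add: nmda_states_def)
  ultimately show ?thesis
    using p Some e by (cases p) auto
qed (simp add: nmda_states_def)

lemma nmda_of: "finite E \<Longrightarrow> is_nmda (nmda_of E i f n) \<and> is_integral (nmda_of E i f n)"
proof -
  assume E: "finite E"
  have "finite (nmda_states E i)"
    using E by (simp add: nmda_states_def finite_tests)
  moreover have "insert (Track i) (tests E) \<subseteq> nmda_states E i"
    by (auto simp: nmda_states_def)
  ultimately show ?thesis
    unfolding nmda_of_def using E succs_nmda by (intro conjI is_nmda_ctrl_nmda) auto
qed

lemma dmda_of: "finite E \<Longrightarrow> is_dmda (dmda_of E) \<and> is_integral (dmda_of E)"
proof -
  assume E: "finite E"
  have "q = q'" if t:
    "(p, a, q) \<in> transitions (dmda_of E)" "(p, a, q') \<in> transitions (dmda_of E)" for p a q q'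
  proof -
    obtain p1 x1 q1 where 1: "p = to_nat p1" "a = to_nat x1" "q = to_nat q1"
      "p1 \<in> {Bad, Sink}" "q1 \<in> succs p1 x1"
      using t(1) unfolding dmda_of_def by (elim in_transitions_ctrl_nmdaE) auto
    obtain p2 x2 q2 where 2: "p = to_nat p2" "a = to_nat x2" "q' = to_nat q2" "q2 \<in> succs p2 x2"
      using t(2) unfolding dmda_of_def by (elim in_transitions_ctrl_nmdaE) auto
    have "p2 = p1" "x2 = x1" using 1 2 by auto
    thus ?thesis using 1 2 by (cases x1) auto
  qed
  moreover have "is_nmda (dmda_of E) \<and> is_integral (dmda_of E)"
    unfolding dmda_of_def using E succs_dmda by (intro conjI is_nmda_ctrl_nmda) auto
  ultimately show ?thesis
    by (auto simp: is_dmda_def dmda_of_def)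
qed

lemma dmda_value:
  assumes "\<And>i. \<omega> i \<in> letters E"
  shows "first_end \<omega> m \<Longrightarrow> nmda_value (dmda_of E) (to_nat \<circ> \<omega>) = ereal (- 2 * (1 / 4) ^ m)"
    and "\<forall>i. \<omega> i \<noteq> None \<Longrightarrow> nmda_value (dmda_of E) (to_nat \<circ> \<omega>) = 0"
proof -
  let ?R = "{\<rho>. is_run {Bad} \<omega> \<rho>}"
  \<comment> \<open>The infimum over an empty set would be \<infinity>, so a run has to be
    exhibited.\<close>
  define \<rho>0 where "\<rho>0 = rec_nat Bad (\<lambda>i q. SOME q'. q' \<in> succs q (\<omega> i))"
  have "is_run {Bad} \<omega> \<rho>0"
    by (simp add: is_run_def \<rho>0_def some_in_eq succs_nonempty)
  hence ne: "?R \<noteq> {}" by blast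
  have v: "nmda_value (dmda_of E) (to_nat \<circ> \<omega>) = (INF \<rho>\<in>?R. ereal (ctrl_value 0 0 \<omega> \<rho>))"
    unfolding dmda_of_def by (rule nmda_value_ctrl_nmda) (use assms succs_dmda in auto)
  show "nmda_value (dmda_of E) (to_nat \<circ> \<omega>) = 0" if "\<forall>i. \<omega> i \<noteq> None"
    unfolding v ctrl_value_no_end[OF that] using ne by (simp add: zero_ereal_def)
  show "nmda_value (dmda_of E) (to_nat \<circ> \<omega>) = ereal (- 2 * (1 / 4) ^ m)" if m: "first_end \<omega> m"
  proof -
    have "ctrl_value 0 0 \<omega> \<rho> = - 2 * (1 / 4) ^ m" if r: "is_run {Bad} \<omega> \<rho>" for \<rho>
    proof -
      have bad: "i \<le> m \<Longrightarrow> \<rho> i = Bad" for i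
      proof (induction i)
        case 0
        show ?case using r by (simp add: is_run_def)
      next
        case (Suc i)
        then obtain e where "\<omega> i = Some e" using m by (fastforce simp: first_end_def)
        thus ?case using Suc r by (metis Suc_leD is_run_def singletonD succs.simps(5))
      qed
      have "(\<Prod>j<m. 1 / of_rat (ctrl_discount (\<rho> j) (\<omega> j)) :: real) = (\<Prod>j<m. 1 / 4)"
        by (intro prod.cong) (auto simp: bad)
      thus ?thesis using bad[of m] by (simp add: ctrl_value_first_end[OF r m])
    qed
    hence "(\<lambda>\<rho>. ereal (ctrl_value 0 0 \<omega> \<rho>)) ` ?R = {ereal (- 2 * (1 / 4) ^ m)}"
      using ne by auto
    thus ?thesis unfolding v by simp
  qed
qed

section \<open>Stores and discounts along a word\<close>

primrec ctrl_at :: "nat \<Rightarrow> (nat \<Rightarrow> edge option) \<Rightarrow> nat \<Rightarrow> ctrl" where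
  "ctrl_at i \<omega> 0 = Track i"
| "ctrl_at i \<omega> (Suc j) = the_elem (succs (ctrl_at i \<omega> j) (\<omega> j))"

definition init_store :: "nat \<Rightarrow> store" where
  "init_store n = (\<lambda>_. 0)(0 := int n)"

definition instr_of :: "edge option \<Rightarrow> instr" where
  "instr_of x = fst (snd (the x))"

text \<open>The instructions are executed without regard to control flow and tests, which
  \<open>accepting\<close> checks separately. Only positions before the first end mark are of
  interest, as \<open>instr_of None\<close> is unspecified.\<close>

primrec store_at :: "nat \<Rightarrow> (nat \<Rightarrow> edge option) \<Rightarrow> nat \<Rightarrow> store" where
  "store_at n \<omega> 0 = init_store n"
| "store_at n \<omega> (Suc j) = (\<lambda>r. store_at n \<omega> j r + effect (instr_of (\<omega> j)) r)"

text \<open>The factors 2, 4 and 8 are 4 / 2 ^ d for d = 1, 0, -1, where d is the change of the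
  difference of the two registers.\<close>

lemma ctrl_discount_Compare:
  "1 / real_of_rat (ctrl_discount (Compare a b) (Some e)) =
     1 / 4 * 2 powi (effect (instr_of (Some e)) a - effect (instr_of (Some e)) b)"
proof -
  obtain u c v where "e = (u, c, v)"
    by (metis surj_pair)
  thus ?thesis
    by (cases c) (auto simp: instr_of_def power_int_minus)
qed

text \<open>The accumulated discount starts at 1 and shows only the change of the difference; the
  payment supplies the initial difference.\<close>

lemma ctrl_weight_Frozen:
  "real_of_rat (ctrl_weight f n (Frozen (input_sign a b)) None) =
    - (2 powi (init_store n a - init_store n b))"
  by (auto simp: input_sign_def init_store_def of_rat_minus of_rat_divide of_rat_power power_int_minus
      field_simps)

definition partial_disc :: "(nat \<Rightarrow> edge option) \<Rightarrow> (nat \<Rightarrow> ctrl) \<Rightarrow> nat \<Rightarrow> real" where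
  "partial_disc \<omega> \<rho> i = (\<Prod>j<i. 1 / real_of_rat (ctrl_discount (\<rho> j) (\<omega> j)))"

lemma partial_disc_simps [simp]:
  "partial_disc \<omega> \<rho> 0 = 1"
  "partial_disc \<omega> \<rho> (Suc i) = partial_disc \<omega> \<rho> i * (1 / real_of_rat (ctrl_discount (\<rho> i) (\<omega> i)))"
  by (simp_all add: partial_disc_def)

lemma partial_disc_Compare_Suc:
  assumes "partial_disc \<omega> \<rho> i =
      (1 / 4) ^ i * 2 powi (store_at n \<omega> i a - store_at n \<omega> i b - (init_store n a - init_store n b))"
    and "\<rho> i = Compare a b" "\<omega> i = Some e"
  shows "partial_disc \<omega> \<rho> (Suc i) = (1 / 4) ^ Suc i *
      2 powi (store_at n \<omega> (Suc i) a - store_at n \<omega> (Suc i) b - (init_store n a - init_store n b))"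
proof -
  have pw: "2 powi (x + y) = 2 powi x * (2 powi y :: real)" for x y
    by (simp add: power_int_add)
  have "store_at n \<omega> (Suc i) a - store_at n \<omega> (Suc i) b - (init_store n a - init_store n b) =
      (store_at n \<omega> i a - store_at n \<omega> i b - (init_store n a - init_store n b)) +
      (effect (instr_of (Some e)) a - effect (instr_of (Some e)) b)"
    using assms(3) by simp
  hence "2 powi (store_at n \<omega> (Suc i) a - store_at n \<omega> (Suc i) b - (init_store n a - init_store n b)) =
      2 powi (store_at n \<omega> i a - store_at n \<omega> i b - (init_store n a - init_store n b)) *
      (2 powi (effect (instr_of (Some e)) a - effect (instr_of (Some e)) b) :: real)"
    by (simp only: pw)
  thus ?thesis
    unfolding partial_disc_simps assms(1) assms(2,3) ctrl_discount_Compare by simp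
qed

text \<open>\<open>Compare\<close> is the only source of nondeterminism and is never entered from
  another state. Hence the run from \<open>Track i\<close> is unique and \<open>the_elem\<close> in
  \<open>ctrl_at\<close> picks its next state.\<close>

lemma succs_not_Compare:
  "\<forall>a b. p \<noteq> Compare a b \<Longrightarrow> \<exists>q. succs p x = {q} \<and> (\<forall>a b. q \<noteq> Compare a b)"
  by (cases "(p, x)" rule: succs.cases) auto

lemma ctrl_at_not_Compare: "ctrl_at i \<omega> j \<noteq> Compare a b"
proof (induction j arbitrary: a b)
  case (Suc j)
  then obtain q where "succs (ctrl_at i \<omega> j) (\<omega> j) = {q}" "\<forall>a b. q \<noteq> Compare a b"
    using succs_not_Compare by metis
  thus ?case by simp
qed simp

lemma run_from_Track:
  assumes "is_run {Track i} \<omega> \<rho>"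
  shows "\<rho> j = ctrl_at i \<omega> j"
proof (induction j)
  case 0
  show ?case using assms by (simp add: is_run_def)
next
  case (Suc j)
  obtain q where "succs (ctrl_at i \<omega> j) (\<omega> j) = {q}"
    using succs_not_Compare ctrl_at_not_Compare by metis
  moreover have "\<rho> (Suc j) \<in> succs (ctrl_at i \<omega> j) (\<omega> j)"
    using assms unfolding is_run_def Suc[symmetric] by blast
  ultimately show ?case by simp
qed

section \<open>Accepting words and containment\<close>

definition accepting :: "nat \<Rightarrow> nat \<Rightarrow> nat \<Rightarrow> (nat \<Rightarrow> edge option) \<Rightarrow> nat \<Rightarrow> bool" where
  "accepting i f n \<omega> m \<longleftrightarrow> ctrl_at i \<omega> m = Track f \<and>
     (\<forall>j<m. \<forall>a b. instr_of (\<omega> j) = Le a b \<longrightarrow> store_at n \<omega> j a \<le> store_at n \<omega> j b)"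

lemma first_endE:
  assumes "first_end \<omega> m" "j < m"
  obtains u c v where "\<omega> j = Some (u, c, v)"
  using assms by (metis first_end_def not_None_eq surj_pair)

lemma store_at_Le:
  assumes "\<omega> j = Some (u, Le a b, v)"
  shows "store_at n \<omega> (Suc j) = store_at n \<omega> j"
  using assms by (simp add: instr_of_def)

lemma run_from_Compare:
  assumes run: "is_run {Compare a b} \<omega> \<rho>" and m: "first_end \<omega> m"
    and le: "\<And>j. j < m \<Longrightarrow> instr_of (\<omega> j) = Le a b \<Longrightarrow> store_at n \<omega> j a \<le> store_at n \<omega> j b"
  shows "j \<le> m \<Longrightarrow>
    \<rho> j = Compare a b \<and> partial_disc \<omega> \<rho> j =
      (1 / 4) ^ j * 2 powi (store_at n \<omega> j a - store_at n \<omega> j b - (init_store n a - init_store n b)) \<or>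
    \<rho> j = Frozen (input_sign a b) \<and>
      partial_disc \<omega> \<rho> j \<le> (1 / 4) ^ j * 2 powi (- (init_store n a - init_store n b))"
proof (induction j)
  case 0
  show ?case using run by (simp add: is_run_def)
next
  case (Suc j)
  obtain u c v where e: "\<omega> j = Some (u, c, v)"
    using m Suc.prems by (elim first_endE) auto
  have step: "\<rho> (Suc j) \<in> succs (\<rho> j) (\<omega> j)"
    using run by (simp add: is_run_def)
  from Suc have "\<rho> j = Compare a b \<and> partial_disc \<omega> \<rho> j =
      (1 / 4) ^ j * 2 powi (store_at n \<omega> j a - store_at n \<omega> j b - (init_store n a - init_store n b)) \<or>
    \<rho> j = Frozen (input_sign a b) \<and>
      partial_disc \<omega> \<rho> j \<le> (1 / 4) ^ j * 2 powi (- (init_store n a - init_store n b))"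
    by simp
  thus ?case
  proof
    assume *: "\<rho> j = Compare a b \<and> partial_disc \<omega> \<rho> j =
      (1 / 4) ^ j * 2 powi (store_at n \<omega> j a - store_at n \<omega> j b - (init_store n a - init_store n b))"
    note pd = partial_disc_Compare_Suc[OF conjunct2[OF *] conjunct1[OF *] e]
    show ?thesis
    proof (cases "\<rho> (Suc j) = Compare a b")
      case False
      hence c: "c = Le a b" and F: "\<rho> (Suc j) = Frozen (input_sign a b)"
        using step * e by (auto split: if_splits)
      have "store_at n \<omega> j a \<le> store_at n \<omega> j b"
        using le[of j] Suc.prems e c by (simp add: instr_of_def)
      \<comment> \<open>The claim is about the position after the test has been read; a test leaves
        the store alone, so the comparison carries over.\<close>
      moreover have "store_at n \<omega> (Suc j) = store_at n \<omega> j"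
        using e c by (intro store_at_Le) simp
      ultimately have "store_at n \<omega> (Suc j) a - store_at n \<omega> (Suc j) b -
          (init_store n a - init_store n b)
          \<le> - (init_store n a - init_store n b)"
        by simp
      hence "partial_disc \<omega> \<rho> (Suc j) \<le> (1 / 4) ^ Suc j * 2 powi (- (init_store n a - init_store n b))"
        unfolding pd by (intro mult_left_mono power_int_increasing) auto
      thus ?thesis using F by simp
    qed (use pd in simp)
  next
    assume *: "\<rho> j = Frozen (input_sign a b) \<and>
      partial_disc \<omega> \<rho> j \<le> (1 / 4) ^ j * 2 powi (- (init_store n a - init_store n b))"
    have "partial_disc \<omega> \<rho> (Suc j) = partial_disc \<omega> \<rho> j / 4"
      using * e by simp
    also have "\<dots> \<le> (1 / 4) ^ Suc j * 2 powi (- (init_store n a - init_store n b))"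
      using * by (simp add: field_simps)
    finally show ?thesis
      using step * e by simp
  qed
qed

lemma nmda_value_nmda_of:
  assumes "\<And>j. \<omega> j \<in> letters E"
  shows "nmda_value (nmda_of E i f n) (to_nat \<circ> \<omega>) =
    (INF \<rho>\<in>{\<rho>. is_run (insert (Track i) (tests E)) \<omega> \<rho>}. ereal (ctrl_value f n \<omega> \<rho>))"
  unfolding nmda_of_def
proof (rule nmda_value_ctrl_nmda)
  show "insert (Track i) (tests E) \<subseteq> nmda_states E i"
    by (auto simp: nmda_states_def)
qed (use assms succs_nmda in auto)

lemma accepting_imp_less:
  assumes \<omega>: "\<And>j. \<omega> j \<in> letters E" and m: "first_end \<omega> m" and acc: "accepting i f n \<omega> m"
  shows "nmda_value (dmda_of E) (to_nat \<circ> \<omega>) < nmda_value (nmda_of E i f n) (to_nat \<circ> \<omega>)"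
proof -
  \<comment> \<open>A uniform bound is proved, since an infimum of values that all exceed -2 / 4 ^ m
    might still equal it.\<close>
  have ge: "ctrl_value f n \<omega> \<rho> \<ge> - ((1 / 4) ^ m)" if run: "is_run (insert (Track i) (tests E)) \<omega> \<rho>" for \<rho>
  proof (cases "\<rho> 0 = Track i")
    case True
    hence "\<rho> m = Track f"
      using run_from_Track[of i \<omega> \<rho> m] run acc by (simp add: is_run_def accepting_def)
    thus ?thesis by (simp add: ctrl_value_first_end[OF run m])
  next
    case False
    then obtain a b where ab: "\<rho> 0 = Compare a b"
      using run by (auto simp: is_run_def tests_def)
    hence "is_run {Compare a b} \<omega> \<rho>"
      using run by (simp add: is_run_def)
    from run_from_Compare[OF this m, of n m] acc
    consider "\<rho> m = Compare a b" | "\<rho> m = Frozen (input_sign a b)"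
      "partial_disc \<omega> \<rho> m \<le> (1 / 4) ^ m * 2 powi (- (init_store n a - init_store n b))"
      by (auto simp: accepting_def)
    thus ?thesis
    proof cases
      case 1
      thus ?thesis by (simp add: ctrl_value_first_end[OF run m])
    next
      case 2
      have "2 powi (init_store n a - init_store n b) * partial_disc \<omega> \<rho> m \<le>
        2 powi (init_store n a - init_store n b) * ((1 / 4) ^ m *
          2 powi (- (init_store n a - init_store n b)))"
        using 2(2) by (intro mult_left_mono) auto
      also have "\<dots> = (1 / 4) ^ m"
        by (simp only: power_int_minus) simp
      finally show ?thesis
        unfolding ctrl_value_first_end[OF run m] 2(1) ctrl_weight_Frozen partial_disc_def[symmetric]
        by simp
    qed
  qed
  have "nmda_value (dmda_of E) (to_nat \<circ> \<omega>) < ereal (- ((1 / 4) ^ m))"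
    using dmda_value(1)[OF \<omega> m] by simp
  also have "\<dots> \<le> nmda_value (nmda_of E i f n) (to_nat \<circ> \<omega>)"
    unfolding nmda_value_nmda_of[OF \<omega>] using ge by (intro INF_greatest) auto
  finally show ?thesis .
qed

lemma is_run_ctrl_at: "is_run {Track i} \<omega> (ctrl_at i \<omega>)"
  unfolding is_run_def
proof (intro conjI allI)
  fix j
  obtain q where "succs (ctrl_at i \<omega> j) (\<omega> j) = {q}"
    using succs_not_Compare ctrl_at_not_Compare by metis
  thus "ctrl_at i \<omega> (Suc j) \<in> succs (ctrl_at i \<omega> j) (\<omega> j)" by simp
qed simp

text \<open>Each failure of acceptance would yield a run of value at most -2 / 4 ^ m, contrary to
  the strict inequality.\<close>

lemma less_imp_accepting:
  assumes \<omega>: "\<And>j. \<omega> j \<in> letters E" and m: "first_end \<omega> m"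
    and less: "nmda_value (dmda_of E) (to_nat \<circ> \<omega>) < nmda_value (nmda_of E i f n) (to_nat \<circ> \<omega>)"
  shows "accepting i f n \<omega> m"
  unfolding accepting_def
proof (intro conjI allI impI)
  have gt: "- 2 * (1 / 4) ^ m < ctrl_value f n \<omega> \<rho>" if "is_run (insert (Track i) (tests E)) \<omega> \<rho>" for \<rho>
  proof -
    have "nmda_value (nmda_of E i f n) (to_nat \<circ> \<omega>) \<le> ereal (ctrl_value f n \<omega> \<rho>)"
      unfolding nmda_value_nmda_of[OF \<omega>] using that by (intro INF_lower) auto
    with less have "ereal (- 2 * (1 / 4) ^ m) < ereal (ctrl_value f n \<omega> \<rho>)"
      unfolding dmda_value(1)[OF \<omega> m] by (rule less_le_trans)
    thus ?thesis by simp
  qed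
  show "ctrl_at i \<omega> m = Track f"
  proof (rule ccontr)
    assume ne: "ctrl_at i \<omega> m \<noteq> Track f"
    have run: "is_run (insert (Track i) (tests E)) \<omega> (ctrl_at i \<omega>)"
      using is_run_ctrl_at by (auto simp: is_run_def)
    have "j \<le> m \<Longrightarrow> ctrl_at i \<omega> j = Bad \<or> (\<exists>p. ctrl_at i \<omega> j = Track p)" for j
    proof (induction j)
      case (Suc j)
      moreover obtain u c v where "\<omega> j = Some (u, c, v)"
        using m Suc.prems by (elim first_endE) auto
      ultimately show ?case by auto
    qed simp
    hence ctrl_weight: "ctrl_weight f n (ctrl_at i \<omega> m) None = - 2"
      using ne by (metis order_refl ctrl_weight.simps(1,2))
    have "ctrl_discount (ctrl_at i \<omega> j) (\<omega> j) = 4" for j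
      using ctrl_at_not_Compare[of i \<omega> j]
      by (cases "(ctrl_at i \<omega> j, \<omega> j)" rule: ctrl_discount.cases) auto
    hence "ctrl_value f n \<omega> (ctrl_at i \<omega>) = - 2 * (1 / 4) ^ m"
      by (simp add: ctrl_value_first_end[OF run m] ctrl_weight power_divide)
    thus False using gt[OF run] by simp
  qed
  fix j a b
  assume j: "j < m" and le: "instr_of (\<omega> j) = Le a b"
  define d where "d = init_store n a - init_store n b"
  define D where "D k = store_at n \<omega> k a - store_at n \<omega> k b" for k
  obtain u v where e: "\<omega> j = Some (u, Le a b, v)"
    using m j le by (elim first_endE) (auto simp: instr_of_def)
  \<comment> \<open>This run claims the failure of the test at position \<open>j\<close>; the ratio
    is frozen from \<open>Suc j\<close> on.\<close>
  define \<rho> where "\<rho> k =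
    (if k \<le> j then Compare a b else if k \<le> m then Frozen (input_sign a b) else Sink)" for k
  have "\<rho> (Suc k) \<in> succs (\<rho> k) (\<omega> k)" for k
  proof -
    consider "k < j" | "k = j" | "j < k" "k < m" | "k = m" | "m < k" by linarith
    thus ?thesis
    proof cases
      case 1
      then obtain u c v where "\<omega> k = Some (u, c, v)"
        using m j by (elim first_endE[of \<omega> m k]) auto
      thus ?thesis using 1 by (simp add: \<rho>_def)
    next
      case 2
      thus ?thesis using e j by (simp add: \<rho>_def)
    next
      case 3
      then obtain u c v where "\<omega> k = Some (u, c, v)"
        using m by (elim first_endE[of \<omega> m k]) auto
      thus ?thesis using 3 by (simp add: \<rho>_def)
    next
      case 4
      thus ?thesis using m j by (simp add: \<rho>_def first_end_def)
    next
      case 5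
      thus ?thesis using j by (cases "\<omega> k") (auto simp: \<rho>_def)
    qed
  qed
  moreover have "Compare a b \<in> tests E"
    using \<omega>[of j] e by (auto simp: letters_def tests_def)
  ultimately have run: "is_run (insert (Track i) (tests E)) \<omega> \<rho>"
    by (simp add: is_run_def \<rho>_def)
  have "k \<le> Suc j \<Longrightarrow> partial_disc \<omega> \<rho> k = (1 / 4) ^ k * 2 powi (D k - d)" for k
  proof (induction k)
    case 0
    show ?case by (simp add: D_def d_def)
  next
    case (Suc k)
    then obtain u c v where "\<omega> k = Some (u, c, v)"
      using m j by (elim first_endE[of \<omega> m k]) auto
    thus ?case
      unfolding D_def d_def using Suc
      by (intro partial_disc_Compare_Suc) (auto simp: \<rho>_def D_def d_def)
  qed
  hence pd: "partial_disc \<omega> \<rho> (Suc j) = (1 / 4) ^ Suc j * 2 powi (D j - d)"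
    using store_at_Le[of \<omega> j u a b v n, OF e] by (simp add: D_def del: partial_disc_simps)
  have "Suc j \<le> m" using j by simp
  hence pd_m: "partial_disc \<omega> \<rho> m = (1 / 4) ^ m * 2 powi (D j - d)"
  proof (induction m rule: dec_induct)
    case base
    show ?case by (rule pd)
  next
    case (step k)
    then obtain u c v where "\<omega> k = Some (u, c, v)"
      using m by (elim first_endE[of \<omega> m k]) auto
    thus ?case using step by (simp add: \<rho>_def)
  qed
  have "ctrl_value f n \<omega> \<rho> = - (2 powi d * ((1 / 4) ^ m * 2 powi (D j - d)))"
  proof -
    have "\<rho> m = Frozen (input_sign a b)" using j by (simp add: \<rho>_def)
    thus ?thesis
      unfolding ctrl_value_first_end[OF run m] partial_disc_def[symmetric]
      by (simp only: ctrl_weight_Frozen d_def[symmetric]) (simp add: pd_m)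
  qed
  also have "\<dots> = - (2 powi D j * (1 / 4) ^ m)"
    by (simp add: power_int_diff)
  finally have lt: "2 powi D j < (2 :: real)"
    using gt[OF run] by simp
  \<comment> \<open>The difference is an integer, so a power of 2 below 2 has an exponent of at most
    0; this is why the payments are in the ratio 1 to 2.\<close>
  have "D j \<le> 0"
  proof (rule ccontr)
    assume "\<not> D j \<le> 0"
    hence "(2 :: real) powi 1 \<le> 2 powi D j"
      by (intro power_int_increasing) auto
    thus False using lt by simp
  qed
  thus "store_at n \<omega> j a \<le> store_at n \<omega> j b"
    by (simp add: D_def)
qed

lemma no_end_imp_le:
  assumes \<omega>: "\<And>j. \<omega> j \<in> letters E" and "\<forall>j. \<omega> j \<noteq> None"
  shows "nmda_value (nmda_of E i f n) (to_nat \<circ> \<omega>) \<le> nmda_value (dmda_of E) (to_nat \<circ> \<omega>)"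
proof -
  have run: "is_run (insert (Track i) (tests E)) \<omega> (ctrl_at i \<omega>)"
    using is_run_ctrl_at by (auto simp: is_run_def)
  have "nmda_value (nmda_of E i f n) (to_nat \<circ> \<omega>) \<le> ereal (ctrl_value f n \<omega> (ctrl_at i \<omega>))"
    unfolding nmda_value_nmda_of[OF \<omega>] using run by (intro INF_lower) auto
  thus ?thesis
    using assms(2) by (simp add: ctrl_value_no_end dmda_value(2)[OF \<omega>] zero_ereal_def)
qed

lemma accepting_imp_path:
  assumes \<omega>: "\<And>j. \<omega> j \<in> letters E" and m: "first_end \<omega> m" and acc: "accepting i f n \<omega> m"
  shows "((i, init_store n), (f, store_at n \<omega> m)) \<in> (graph_step E)\<^sup>*"
proof -
  have "k \<le> m \<Longrightarrow> ctrl_at i \<omega> k = Track p \<Longrightarrow>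
      ((i, init_store n), (p, store_at n \<omega> k)) \<in> (graph_step E)\<^sup>*" for k p
  proof (induction k arbitrary: p)
    case (Suc k)
    obtain u c v where e: "\<omega> k = Some (u, c, v)"
      using m Suc.prems by (elim first_endE[of \<omega> m k]) auto
    \<comment> \<open>None of \<open>Bad\<close>, \<open>Frozen\<close> and \<open>Sink\<close>
      leads back to \<open>Track\<close>, so the edge just read starts at the tracked node.\<close>
    have "ctrl_at i \<omega> k = Track u" "p = v"
      using Suc.prems(2) e ctrl_at_not_Compare[of i \<omega> k]
      by (cases "ctrl_at i \<omega> k"; auto split: if_splits)+
    moreover have "(u, c, v) \<in> E"
      using \<omega>[of k] e by (auto simp: letters_def)
    moreover have "(store_at n \<omega> k, store_at n \<omega> (Suc k)) \<in> instr_sem c"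
      using acc Suc.prems(1) e by (auto simp: instr_sem_def accepting_def instr_of_def)
    ultimately have "((u, store_at n \<omega> k), (p, store_at n \<omega> (Suc k))) \<in> graph_step E"
      by (auto simp: graph_step_def)
    moreover have "((i, init_store n), (u, store_at n \<omega> k)) \<in> (graph_step E)\<^sup>*"
      using Suc.IH Suc.prems(1) \<open>ctrl_at i \<omega> k = Track u\<close> by simp
    ultimately show ?case
      by (rule rtrancl_into_rtrancl[rotated])
  qed simp
  thus ?thesis using acc by (simp add: accepting_def)
qed

lemma path_imp_accepting:
  assumes "((i, init_store n), (f, t)) \<in> (graph_step E)\<^sup>*"
  shows "\<exists>\<omega> m. (\<forall>j. \<omega> j \<in> letters E) \<and> first_end \<omega> m \<and> accepting i f n \<omega> m"
proof -
  obtain m where "((i, init_store n), (f, t)) \<in> graph_step E ^^ m"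
    using assms by (auto simp: rtrancl_power)
  then obtain g where g: "g 0 = (i, init_store n)" "g m = (f, t)"
    "\<And>j. j < m \<Longrightarrow> (g j, g (Suc j)) \<in> graph_step E"
    by (auto simp: relpow_fun_conv)
  have "\<exists>c. (fst (g j), c, fst (g (Suc j))) \<in> E \<and> (snd (g j), snd (g (Suc j))) \<in> instr_sem c"
    if "j < m" for j
    using g(3)[OF that] by (auto simp: graph_step_def case_prod_unfold)
  then obtain c where c: "\<And>j. j < m \<Longrightarrow> (fst (g j), c j, fst (g (Suc j))) \<in> E"
    "\<And>j. j < m \<Longrightarrow> (snd (g j), snd (g (Suc j))) \<in> instr_sem (c j)"
    by metis
  \<comment> \<open>The word spells the edges of the path and continues with end marks, the first of
    them at position \<open>m\<close>.\<close>
  define \<omega> where "\<omega> j = (if j < m then Some (fst (g j), c j, fst (g (Suc j))) else None)" for j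
  have "j \<le> m \<Longrightarrow> ctrl_at i \<omega> j = Track (fst (g j)) \<and> store_at n \<omega> j = snd (g j)" for j
  proof (induction j)
    case (Suc j)
    thus ?case using c(2)[of j] by (simp add: \<omega>_def instr_of_def instr_sem_def)
  qed (simp add: g)
  hence "accepting i f n \<omega> m"
    using c(2) g(2) by (auto simp: accepting_def \<omega>_def instr_of_def instr_sem_def)
  moreover have "\<omega> j \<in> letters E" for j
    using c(1) by (auto simp: \<omega>_def letters_def)
  moreover have "first_end \<omega> m"
    by (auto simp: first_end_def \<omega>_def)
  ultimately show ?thesis by blast
qed

text \<open>On a word without end mark the deterministic value is 0 and the run from
  \<open>Track i\<close> has value 0 as well; on any other word the prefix before the first end mark
  decides.\<close>

lemma containment_iff:
  "(\<forall>w\<in>words (alphabet (nmda_of E i f n)). nmda_value (nmda_of E i f n) w \<le> nmda_value (dmda_of E) w)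
   \<longleftrightarrow> \<not> (\<exists>t. ((i, init_store n), (f, t)) \<in> (graph_step E)\<^sup>*)" (is "?C \<longleftrightarrow> \<not> ?P")
proof
  assume C: ?C
  show "\<not> ?P"
  proof
    assume ?P
    then obtain t where "((i, init_store n), (f, t)) \<in> (graph_step E)\<^sup>*"
      by blast
    then obtain \<omega> m where \<omega>: "\<And>j. \<omega> j \<in> letters E" "first_end \<omega> m" "accepting i f n \<omega> m"
      using path_imp_accepting by blast
    have "to_nat \<circ> \<omega> \<in> words (alphabet (nmda_of E i f n))"
      using \<omega>(1) by (simp add: words_def nmda_of_def)
    thus False using C accepting_imp_less[OF \<omega>] by (simp add: leD)
  qed
next
  assume P: "\<not> ?P"
  show ?C
  proof
    fix w assume "w \<in> words (alphabet (nmda_of E i f n))"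
    then obtain \<omega> where w: "w = to_nat \<circ> \<omega>" and \<omega>: "\<And>j. \<omega> j \<in> letters E"
      unfolding nmda_of_def using words_ctrl_nmda by blast
    show "nmda_value (nmda_of E i f n) w \<le> nmda_value (dmda_of E) w"
    proof (cases "\<forall>j. \<omega> j \<noteq> None")
      case True
      thus ?thesis unfolding w using no_end_imp_le[of \<omega> E, OF \<omega>] by blast
    next
      case False
      define m where "m = (LEAST j. \<omega> j = None)"
      have m: "first_end \<omega> m"
        unfolding first_end_def
      proof (intro conjI allI impI)
        have "\<exists>j. \<omega> j = None"
          using False by (simp only: not_all not_not)
        thus "\<omega> m = None"
          unfolding m_def by (rule LeastI_ex)
        show "\<omega> j \<noteq> None" if "j < m" for j
          using that unfolding m_def by (rule not_less_Least)
      qed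
      show ?thesis
      proof (rule ccontr)
        assume "\<not> nmda_value (nmda_of E i f n) w \<le> nmda_value (dmda_of E) w"
        hence "accepting i f n \<omega> m"
          using less_imp_accepting[of \<omega> E m i f n, OF \<omega> m] w by simp
        from accepting_imp_path[OF \<omega> m this] show False
          using P by simp
      qed
    qed
  qed
qed


section \<open>Computing the codes of the automata\<close>

definition computable :: "nat \<Rightarrow> (nat list \<Rightarrow> nat) \<Rightarrow> bool" where
  "computable k F \<longleftrightarrow> (\<exists>f. \<forall>xs. length xs = k \<longrightarrow> recf_eval f xs (F xs))"

lemma computable_nth: "i < k \<Longrightarrow> computable k (\<lambda>xs. xs ! i)"
  unfolding computable_def using recf_eval.Proj by blast

lemma computable_comp1:
  assumes "\<exists>f. \<forall>x. recf_eval f [x] (F x)" "computable k G"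
  shows "computable k (\<lambda>xs. F (G xs))"
proof -
  obtain f g where "\<And>x. recf_eval f [x] (F x)" "\<And>xs. length xs = k \<Longrightarrow> recf_eval g xs (G xs)"
    using assms unfolding computable_def by blast
  hence "\<forall>xs. length xs = k \<longrightarrow> recf_eval (Comp f [g]) xs (F (G xs))"
    by (auto intro!: recf_eval.Comp[where ys = "[y]" for y])
  thus ?thesis unfolding computable_def by blast
qed

lemma computable_comp2:
  assumes "\<exists>f. \<forall>x y. recf_eval f [x, y] (F x y)" "computable k G" "computable k H"
  shows "computable k (\<lambda>xs. F (G xs) (H xs))"
proof -
  obtain f g h where "\<And>x y. recf_eval f [x, y] (F x y)"
    "\<And>xs. length xs = k \<Longrightarrow> recf_eval g xs (G xs)" "\<And>xs. length xs = k \<Longrightarrow> recf_eval h xs (H xs)"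
    using assms unfolding computable_def by blast
  hence "\<forall>xs. length xs = k \<longrightarrow> recf_eval (Comp f [g, h]) xs (F (G xs) (H xs))"
    by (auto intro!: recf_eval.Comp[where ys = "[y, z]" for y z])
  thus ?thesis unfolding computable_def by blast
qed

lemma computable2_iff:
  "(\<exists>f. \<forall>x y. recf_eval f [x, y] (F x y)) \<longleftrightarrow> computable 2 (\<lambda>xs. F (xs ! 0) (xs ! 1))"
proof -
  have "(\<forall>x y. recf_eval f [x, y] (F x y)) \<longleftrightarrow>
      (\<forall>xs. length xs = 2 \<longrightarrow> recf_eval f xs (F (xs ! 0) (xs ! 1)))" for f
  proof
    assume *: "\<forall>xs. length xs = 2 \<longrightarrow> recf_eval f xs (F (xs ! 0) (xs ! 1))"
    show "\<forall>x y. recf_eval f [x, y] (F x y)"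
      using *[rule_format, of "[x, y]" for x y] by simp
  qed (auto simp: length_Suc_conv numeral_2_eq_2)
  thus ?thesis by (simp add: computable_def)
qed

lemma computable_Suc: "computable k F \<Longrightarrow> computable k (\<lambda>xs. Suc (F xs))"
  by (rule computable_comp1[where F = Suc]) (use recf_eval.Succ in blast)

lemma computable_const: "computable k (\<lambda>xs. c)"
proof (induction c)
  case 0
  show ?case unfolding computable_def using recf_eval.Zero by blast
qed (rule computable_Suc)

lemma computable_rec1:
  assumes "computable 2 (\<lambda>xs. G (xs ! 0) (xs ! 1))"
  shows "\<exists>f. \<forall>x. recf_eval f [x] (rec_nat c G x)"
proof -
  obtain z where z: "\<And>xs. length xs = 0 \<Longrightarrow> recf_eval z xs c"
    using computable_const[of 0 c] unfolding computable_def by blast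
  obtain g where g: "\<And>x y. recf_eval g [x, y] (G x y)"
    using assms unfolding computable2_iff[symmetric] by blast
  have "recf_eval (PrimRec z g) [x] (rec_nat c G x)" for x
    by (induction x) (auto intro: recf_eval.PrimRec_0 recf_eval.PrimRec_Suc z g)
  thus ?thesis by blast
qed

lemma computable_add:
  assumes "computable k F" "computable k G"
  shows "computable k (\<lambda>xs. F xs + G xs)"
proof (rule computable_comp2[OF _ assms])
  have "recf_eval (PrimRec (Proj 0) (Comp Succ [Proj 1])) [x, y] (x + y)" for x y
  proof (induction x)
    case 0
    show ?case using recf_eval.Proj[of 0 "[y]"] by (auto intro: recf_eval.PrimRec_0)
  next
    case (Suc x)
    have "recf_eval (Proj 1) [x, x + y, y] (x + y)"
      using recf_eval.Proj[of 1 "[x, x + y, y]"] by simp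
    hence "recf_eval (Comp Succ [Proj 1]) [x, x + y, y] (Suc (x + y))"
      by (intro recf_eval.Comp[where ys = "[x + y]"] recf_eval.Succ) simp
    with Suc show ?case by (auto intro: recf_eval.PrimRec_Suc)
  qed
  thus "\<exists>f. \<forall>x y. recf_eval f [x, y] (x + y)" by blast
qed

lemma computable_power2:
  assumes "computable k F"
  shows "computable k (\<lambda>xs. 2 ^ F xs)"
proof (rule computable_comp1[OF _ assms])
  have "rec_nat 1 (\<lambda>_ y. y + y) x = (2 ^ x :: nat)" for x :: nat
    by (induction x) auto
  moreover have "\<exists>f. \<forall>x. recf_eval f [x] (rec_nat 1 (\<lambda>_ y. y + y) x)"
    by (intro computable_rec1 computable_add computable_nth) auto
  ultimately show "\<exists>f. \<forall>x. recf_eval f [x] (2 ^ x)" by simp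
qed

lemma computable_triangle:
  assumes "computable k F"
  shows "computable k (\<lambda>xs. triangle (F xs))"
proof (rule computable_comp1[OF _ assms])
  have "rec_nat 0 (\<lambda>x y. y + Suc x) x = triangle x" for x :: nat
    by (induction x) auto
  moreover have "\<exists>f. \<forall>x. recf_eval f [x] (rec_nat 0 (\<lambda>x y. y + Suc x) x)"
    by (intro computable_rec1 computable_add computable_Suc computable_nth) auto
  ultimately show "\<exists>f. \<forall>x. recf_eval f [x] (triangle x)" by simp
qed

lemma computable_prod_encode:
  "computable k F \<Longrightarrow> computable k G \<Longrightarrow> computable k (\<lambda>xs. prod_encode (F xs, G xs))"
  unfolding prod_encode_def prod.case by (intro computable_add computable_triangle)

lemma computable_list_encode_Nil: "computable k (\<lambda>xs. list_encode [])"
  by (rule computable_const)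

lemma computable_list_encode_Cons:
  "computable k F \<Longrightarrow> computable k (\<lambda>xs. list_encode (G xs)) \<Longrightarrow>
     computable k (\<lambda>xs. list_encode (F xs # G xs))"
  unfolding list_encode.simps by (intro computable_Suc computable_prod_encode)

lemmas computable_intros = computable_nth computable_const computable_Suc computable_add
  computable_power2 computable_prod_encode computable_list_encode_Nil computable_list_encode_Cons

text \<open>\<open>int_encode\<close> sends -m with m > 0 to 2 (m - 1) + 1 and a natural number m to
  2 m; the denominator is 1 here.\<close>

lemma rat_encode_power2: "rat_encode (- (2 ^ n)) = prod_encode (Suc (2 * (2 ^ n - 1)), 2)"
proof -
  have "(- (2 ^ n) :: rat) = of_int (- (2 ^ n))" by simp
  hence "quotient_of (- (2 ^ n)) = (- (2 ^ n), 1)"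
    by (simp only: quotient_of_rat_of_int)
  thus ?thesis
    by (simp add: rat_encode_def int_encode_def sum_encode_def nat_diff_distrib' nat_power_eq)
qed

lemma rat_encode_inverse_power2: "rat_encode (- (1 / 2 ^ n)) = prod_encode (1, 2 * 2 ^ n)"
proof -
  have "(- (1 / 2 ^ n) :: rat) = Fract (- 1) (2 ^ n)"
    by (simp add: Fract_of_int_quotient)
  hence "quotient_of (- (1 / 2 ^ n)) = (- 1, 2 ^ n)"
    by (simp add: quotient_of_Fract normalize_def)
  thus ?thesis
    by (simp add: rat_encode_def int_encode_def sum_encode_def nat_power_eq)
qed

lemma computable_rat_encode_power2:
  assumes "computable k F"
  shows "computable k (\<lambda>xs. rat_encode (- (2 ^ F xs)))"
proof -
  \<comment> \<open>The code of the numerator is 2 ^ (x + 1) - 1, obtained from 1 by iterating y to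
    2 y + 1; the recursion avoids subtraction.\<close>
  have "rec_nat 1 (\<lambda>_ y. Suc (y + y)) x = Suc (2 * (2 ^ x - 1))" for x :: nat
  proof (induction x)
    case (Suc x)
    obtain y where "(2::nat) ^ x = Suc y"
      using not0_implies_Suc[of "2 ^ x"] by auto
    thus ?case using Suc by simp
  qed simp
  moreover have "\<exists>f. \<forall>x. recf_eval f [x] (rec_nat 1 (\<lambda>_ y. Suc (y + y)) x)"
    by (intro computable_rec1 computable_intros) auto
  ultimately have "\<exists>f. \<forall>x. recf_eval f [x] (Suc (2 * (2 ^ x - 1)))" by simp
  from computable_prod_encode[OF computable_comp1[OF this assms] computable_const[of k 2]]
  show ?thesis
    unfolding rat_encode_power2 .
qed

lemma computable_rat_encode_inverse_power2:
  "computable k F \<Longrightarrow> computable k (\<lambda>xs. rat_encode (- (1 / 2 ^ F xs)))"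
  unfolding rat_encode_inverse_power2 mult_2 by (intro computable_intros)

definition end_code :: "nat \<Rightarrow> rat \<Rightarrow> nat" where
  "end_code k x = list_encode
     [to_nat (Frozen k), to_nat (None :: edge option), to_nat Sink, rat_encode x, rat_encode 4]"

text \<open>\<open>set_encode\<close> is the sum of 2 ^ c over the elements c. Only two transitions
  have codes that depend on \<open>n\<close>, so the sum over all others is the constant
  \<open>t\<close>.\<close>

lemma nmda_encode_nmda_of:
  assumes E: "finite E"
  shows "\<exists>t. \<forall>n. nmda_encode (nmda_of E i f n) =
    list_encode [set_encode (to_nat ` letters E), set_encode (to_nat ` nmda_states E i),
      set_encode (to_nat ` insert (Track i) (tests E)),
      t + (2 ^ end_code 1 (- (2 ^ n)) + 2 ^ end_code 2 (- (1 / 2 ^ n)))]"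
proof -
  define u where "u k = (to_nat (Frozen k), to_nat (None :: edge option), to_nat Sink)" for k
  define T where "T = transitions (nmda_of E i f 0)"
  have T: "transitions (nmda_of E i f n) = T" for n
    by (simp add: T_def nmda_of_def ctrl_nmda_def)
  have fin: "finite T"
    using nmda_of[OF E, of i f 0] finite_subset[of T]
    by (auto simp: is_nmda_def T_def)
  have u: "u 1 \<in> T" "u 2 \<in> T" "u 1 \<noteq> u 2"
    by (simp_all add: u_def T_def nmda_of_def transitions_ctrl_nmda nmda_states_def letters_def)
  have code_u: "trans_encode (nmda_of E i f n) (u k) = end_code k (ctrl_weight f n (Frozen k) None)"
    for n k
    by (simp add: trans_encode_def u_def end_code_def nmda_of_def)
  have other: "trans_encode (nmda_of E i f n) v = trans_encode (nmda_of E i f 0) v"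
    if v: "v \<in> T - {u 1, u 2}" for v n
  proof -
    have "v \<in> transitions (ctrl_nmda E (nmda_states E i) (insert (Track i) (tests E)) f 0)"
      using v by (simp add: T_def nmda_of_def)
    then obtain p x q where pxq: "v = (to_nat p, to_nat x, to_nat q)" "q \<in> succs p x"
      by (rule in_transitions_ctrl_nmdaE)
    have "\<not> (x = None \<and> p \<in> {Frozen 1, Frozen 2})"
    proof
      assume x: "x = None \<and> p \<in> {Frozen 1, Frozen 2}"
      hence "q = Sink" using pxq(2) by simp
      thus False using v x pxq(1) by (auto simp: u_def)
    qed
    hence "ctrl_weight f n p x = ctrl_weight f 0 p x"
      by (cases "(f, n, p, x)" rule: ctrl_weight.cases) auto
    thus ?thesis
      by (simp add: trans_encode_def pxq nmda_of_def)
  qed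
  \<comment> \<open>The triple itself is part of the code, so different transitions have different
    codes whatever their weights are.\<close>
  have inj: "inj_on (trans_encode A) T" for A
    by (rule inj_onI) (auto simp: trans_encode_def)
  have "set_encode (trans_encode (nmda_of E i f n) ` T) =
      (\<Sum>v\<in>T - {u 1, u 2}. 2 ^ trans_encode (nmda_of E i f 0) v) +
      (2 ^ end_code 1 (- (2 ^ n)) + 2 ^ end_code 2 (- (1 / 2 ^ n)))" for n
  proof -
    have "set_encode (trans_encode (nmda_of E i f n) ` T) =
        (\<Sum>v\<in>T. 2 ^ trans_encode (nmda_of E i f n) v)"
      unfolding set_encode_def by (simp add: sum.reindex[OF inj])
    also have "\<dots> = (\<Sum>v\<in>T - {u 1, u 2}. 2 ^ trans_encode (nmda_of E i f n) v) +
        (\<Sum>v\<in>{u 1, u 2}. 2 ^ trans_encode (nmda_of E i f n) v)"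
      by (rule sum.subset_diff) (use u fin in auto)
    also have "(\<Sum>v\<in>T - {u 1, u 2}. 2 ^ trans_encode (nmda_of E i f n) v) =
        (\<Sum>v\<in>T - {u 1, u 2}. 2 ^ trans_encode (nmda_of E i f 0) v :: nat)"
      by (intro sum.cong[OF refl] arg_cong[of _ _ "\<lambda>k. 2 ^ k"] other)
    finally show ?thesis
      using u(3) by (simp add: code_u)
  qed
  hence "nmda_encode (nmda_of E i f n) =
    list_encode [set_encode (to_nat ` letters E), set_encode (to_nat ` nmda_states E i),
      set_encode (to_nat ` insert (Track i) (tests E)),
      (\<Sum>v\<in>T - {u 1, u 2}. 2 ^ trans_encode (nmda_of E i f 0) v) +
      (2 ^ end_code 1 (- (2 ^ n)) + 2 ^ end_code 2 (- (1 / 2 ^ n)))]" for n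
    unfolding nmda_encode_def T by (simp only: nmda_of_def ctrl_nmda_simps)
  thus ?thesis by blast
qed

section \<open>The diagonal instance\<close>

definition param_code :: "nat list \<Rightarrow> nat" where
  "param_code xs = list_encode [xs ! 0, xs ! 1, xs ! 2, xs ! 3, xs ! 4]"

text \<open>The entries of \<open>xs\<close> are the codes of the alphabet, of the states, of the initial states, of
  the transitions whose weight does not depend on the input, and of the deterministic automaton.\<close>

definition self_instance :: "nat list \<Rightarrow> nat" where
  "self_instance xs = prod_encode (list_encode [xs ! 0, xs ! 1, xs ! 2,
     xs ! 3 + (2 ^ end_code 1 (- (2 ^ param_code xs)) + 2 ^ end_code 2 (- (1 / 2 ^ param_code xs)))],
     xs ! 4)"

lemma computable_param_code: "computable 5 param_code"
  unfolding param_code_def by (intro computable_intros) auto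

lemma computable_self_instance: "computable 5 self_instance"
  unfolding self_instance_def end_code_def
  by (intro computable_intros computable_rat_encode_power2 computable_rat_encode_inverse_power2
      computable_param_code) auto

lemma ex_test_ex: "\<exists>P. is_test (Suc k) P Q \<Longrightarrow> \<exists>P. is_test k P (\<lambda>\<sigma>. \<exists>v. Q (\<sigma>(k := v)))"
  using is_test_ex by blast

text \<open>The program guesses the five parameters in registers 1 to 5 and the answer of
  \<open>g\<close> in register 6, and checks that register 0 holds the code of the
  parameters.\<close>

lemma self_application:
  assumes e: "\<And>xs. length xs = 5 \<Longrightarrow> recf_eval e xs (param_code xs)"
  shows "\<exists>P. \<forall>n. (\<exists>t. (init_store n, t) \<in> sem P) \<longleftrightarrow>
    (\<exists>xs. length xs = 5 \<and> n = list_encode xs \<and> recf_eval g xs 1)"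
proof -
  \<comment> \<open>\<open>Comp Succ [Zero]\<close> denotes the constant 1 and forces register 6 to
    contain 1.\<close>
  define Q where "Q \<sigma> \<longleftrightarrow> recf_eval e (map \<sigma> [1, 2, 3, 4, 5]) (\<sigma> 0) \<and>
    recf_eval g (map \<sigma> [1, 2, 3, 4, 5]) (\<sigma> 6) \<and> recf_eval (Comp Succ [Zero]) (map \<sigma> []) (\<sigma> 6)"
    for \<sigma> :: "nat \<Rightarrow> nat"
  obtain Pe where Pe: "is_test 7 Pe (\<lambda>\<sigma>. recf_eval e (map \<sigma> [1, 2, 3, 4, 5]) (\<sigma> 0))"
    using testableD[OF testable[of e], of "[1, 2, 3, 4, 5]" 7 0] by force
  obtain Pg where Pg: "is_test 7 Pg (\<lambda>\<sigma>. recf_eval g (map \<sigma> [1, 2, 3, 4, 5]) (\<sigma> 6))"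
    using testableD[OF testable[of g], of "[1, 2, 3, 4, 5]" 7 6] by force
  obtain P1 where P1: "is_test 7 P1 (\<lambda>\<sigma>. recf_eval (Comp Succ [Zero]) (map \<sigma> []) (\<sigma> 6))"
    using testableD[OF testable[of "Comp Succ [Zero]"], of "[]" 7 6] by force
  have "is_test (Suc (Suc (Suc (Suc (Suc (Suc 1)))))) (Seq Pe (Seq Pg P1)) Q"
    using is_test_Seq[OF Pe is_test_Seq[OF Pg P1]] unfolding Q_def by (simp add: eval_nat_numeral)
  hence "\<exists>P. is_test (Suc (Suc (Suc (Suc (Suc (Suc 1)))))) P Q" by blast
  from ex_test_ex[OF ex_test_ex[OF ex_test_ex[OF ex_test_ex[OF ex_test_ex[OF ex_test_ex[OF this]]]]]]
  obtain P where P: "is_test 1 P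
    (\<lambda>\<sigma>. \<exists>a b c d x y. Q (\<sigma>(1 := a, 2 := b, 3 := c, 4 := d, 5 := x, 6 := y)))"
    by (auto simp: eval_nat_numeral)
  have e_iff: "recf_eval e [a, b, c, d, x] n \<longleftrightarrow> n = list_encode [a, b, c, d, x]" for a b c d x n
    using e[of "[a, b, c, d, x]"] recf_eval_deterministic
    by (auto simp: param_code_def simp del: list_encode.simps)
  have "recf_eval (Comp Succ [Zero]) [] (Suc 0)"
    by (rule recf_eval.Comp[where ys = "[0]"]) (auto intro: recf_eval.Zero recf_eval.Succ)
  hence one: "recf_eval (Comp Succ [Zero]) [] y \<longleftrightarrow> y = 1" for y
    using recf_eval_deterministic by auto
  have "(\<exists>t. (init_store n, t) \<in> sem P) \<longleftrightarrow>
    (\<exists>a b c d x. n = list_encode [a, b, c, d, x] \<and> recf_eval g [a, b, c, d, x] 1)" for n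
  proof -
    have "init_store n = int \<circ> (\<lambda>_. 0)(0 := n)"
      by (auto simp: init_store_def)
    moreover have "(int \<circ> (\<lambda>_. 0)(0 := n), t) \<in> sem P \<longleftrightarrow> t = int \<circ> (\<lambda>_. 0)(0 := n) \<and>
      (\<exists>a b c d x. n = list_encode [a, b, c, d, x] \<and> recf_eval g [a, b, c, d, x] 1)" for t
      by (subst is_testD[OF P]) (auto simp: Q_def e_iff one simp del: list_encode.simps)
    ultimately show ?thesis by auto
  qed
  also have "(\<exists>a b c d x. n = list_encode [a, b, c, d, x] \<and> recf_eval g [a, b, c, d, x] 1) \<longleftrightarrow>
    (\<exists>xs. length xs = 5 \<and> n = list_encode xs \<and> recf_eval g xs 1)" for n
  proof
    assume "\<exists>xs. length xs = 5 \<and> n = list_encode xs \<and> recf_eval g xs 1"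
    then obtain xs where xs: "length xs = 5" "n = list_encode xs" "recf_eval g xs 1" by blast
    from xs(1) obtain a b c d x where "xs = [a, b, c, d, x]"
      by (auto simp: length_Suc_conv eval_nat_numeral)
    with xs show "\<exists>a b c d x. n = list_encode [a, b, c, d, x] \<and> recf_eval g [a, b, c, d, x] 1"
      by blast
  next
    assume "\<exists>a b c d x. n = list_encode [a, b, c, d, x] \<and> recf_eval g [a, b, c, d, x] 1"
    then obtain a b c d x where "n = list_encode [a, b, c, d, x]" "recf_eval g [a, b, c, d, x] 1"
      by blast
    thus "\<exists>xs. length xs = 5 \<and> n = list_encode xs \<and> recf_eval g xs 1"
      by (intro exI[of _ "[a, b, c, d, x]"]) simp
  qed
  finally show ?thesis by blast
qed

theorem theorem3p6:
  "\<not> decidable pair_encode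
      {(N, D). is_nmda N \<and> is_integral N \<and> is_dmda D \<and> is_integral D \<and> alphabet N = alphabet D}
      (\<lambda>(N, D). \<forall>w\<in>words (alphabet N). nmda_value N w \<le> nmda_value D w)"
proof
  assume "decidable pair_encode
      {(N, D). is_nmda N \<and> is_integral N \<and> is_dmda D \<and> is_integral D \<and> alphabet N = alphabet D}
      (\<lambda>(N, D). \<forall>w\<in>words (alphabet N). nmda_value N w \<le> nmda_value D w)"
  then obtain d where d: "\<And>N D. is_nmda N \<Longrightarrow> is_integral N \<Longrightarrow> is_dmda D \<Longrightarrow> is_integral D \<Longrightarrow>
      alphabet N = alphabet D \<Longrightarrow> recf_eval d [pair_encode (N, D)]
        (if \<forall>w\<in>words (alphabet N). nmda_value N w \<le> nmda_value D w then 1 else 0)"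
    unfolding decidable_def by fastforce
  obtain e where e: "\<And>xs. length xs = 5 \<Longrightarrow> recf_eval e xs (param_code xs)"
    using computable_param_code unfolding computable_def by blast
  obtain h where h: "\<And>xs. length xs = 5 \<Longrightarrow> recf_eval h xs (self_instance xs)"
    using computable_self_instance unfolding computable_def by blast
  \<comment> \<open>\<open>g\<close> runs the decision procedure on the instance described by five
    numbers, with their own code as the input.\<close>
  define g where "g = Comp d [h]"
  obtain P where P: "\<And>n. (\<exists>t. (init_store n, t) \<in> sem P) \<longleftrightarrow>
      (\<exists>xs. length xs = 5 \<and> n = list_encode xs \<and> recf_eval g xs 1)"
    using self_application[OF e, of g] by blast
  obtain E f where E: "flow P 0 = (E, f)"
    by (metis surj_pair)
  have fin: "finite E"
    using flow_bounds[OF E] by blast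
  obtain t where t: "\<And>n. nmda_encode (nmda_of E 0 f n) =
    list_encode [set_encode (to_nat ` letters E), set_encode (to_nat ` nmda_states E 0),
      set_encode (to_nat ` insert (Track 0) (tests E)),
      t + (2 ^ end_code 1 (- (2 ^ n)) + 2 ^ end_code 2 (- (1 / 2 ^ n)))]"
    using nmda_encode_nmda_of[OF fin] by blast
  \<comment> \<open>These numbers describe the automata of \<open>P\<close> itself. None of them
    depends on the input, so their code may be chosen as the input without circularity.\<close>
  define xs where "xs = [set_encode (to_nat ` letters E), set_encode (to_nat ` nmda_states E 0),
      set_encode (to_nat ` insert (Track 0) (tests E)), t, nmda_encode (dmda_of E)]"
  define n where "n = list_encode xs"
  define C where "C \<longleftrightarrow> (\<forall>w\<in>words (alphabet (nmda_of E 0 f n)).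
      nmda_value (nmda_of E 0 f n) w \<le> nmda_value (dmda_of E) w)"
  have len: "length xs = 5"
    by (simp add: xs_def)
  have "param_code xs = n"
    by (simp add: param_code_def n_def xs_def)
  hence "pair_encode (nmda_of E 0 f n, dmda_of E) = self_instance xs"
    by (simp add: pair_encode_def self_instance_def t) (simp add: xs_def)
  moreover have "alphabet (nmda_of E 0 f n) = alphabet (dmda_of E)"
    by (simp add: nmda_of_def dmda_of_def)
  ultimately have "recf_eval d [self_instance xs] (if C then 1 else 0)"
    unfolding C_def using d[of "nmda_of E 0 f n" "dmda_of E"] nmda_of[OF fin] dmda_of[OF fin] by simp
  hence g: "recf_eval g xs (if C then 1 else 0)"
    unfolding g_def using h[OF len] by (auto intro!: recf_eval.Comp[where ys = "[self_instance xs]"])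
  have "C \<longleftrightarrow> \<not> (\<exists>t. (init_store n, t) \<in> sem P)"
    unfolding C_def containment_iff using flow_sound[OF E] flow_complete[OF E] by blast
  \<comment> \<open>As \<open>list_encode\<close> is injective, \<open>xs\<close> is the only
    possible guess of \<open>P\<close> on the input \<open>n\<close>.\<close>
  also have "\<dots> \<longleftrightarrow> \<not> recf_eval g xs 1"
    unfolding P n_def using len by (auto simp: list_encode_eq)
  finally have "C \<longleftrightarrow> \<not> recf_eval g xs 1" .
  \<comment> \<open>If \<open>C\<close> holds, \<open>g\<close> answers 1, contrary to the
    equivalence; otherwise \<open>g\<close> answers both 0 and 1.\<close>
  thus False
    using g recf_eval_deterministic[of g xs 1 0] by (auto split: if_splits)
qed

end
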